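(* Let $k$ be a field and let $m,n$ be positive integers. The number of isomorphism types of good $C_n$-gradings of the algebra $\mathrm{M}_m(k)$, where $C_n$ is the cyclic group of order $n$, is $$\sum_{d\in\mathcal{D}(n,m)}\frac1d|B_d|=\sum_{d\in\mathcal{D}(n,m)}\frac1d\Bigl(|A_d|-\Bigl|\bigcup_{d'\in\mathcal{D}_0(n,m,d)}A_{d'}\Bigr|\Bigr).$$
   Context: A $G$-grading of a $k$-algebra $A$ is a decomposition $A=\bigoplus_{g\in G}A_g$ into subspaces with $A_gA_h\subseteq A_{gh}$ for all $g,h\in G$; two gradings are isomorphic if there is an algebra isomorphism preserving degrees. A grading of $\mathrm{M}_m(k)$ is good if all matrix units $e_{ij}$ are homogeneous. $F_{n,m}$ is the set of all $n$-tuples $(k_0,k_1,\ldots,k_{n-1})$ of non-negative integers with $k_0+\cdots+k_{n-1}=m$. The subgroup $H=\langle\tau\rangle$ of the symmetric group $\mathcal{S}_n$ generated by the cyclic permutation $\tau=(1\;2\;\ldots\;n)$ acts on $F_{n,m}$ by permuting (cyclically shifting) the $n$ positions. $\mathcal{D}(n,m)$ is the set of all positive divisors $d$ of $n$ such that $n/d$ divides $m$. For $d\in\mathcal{D}(n,m)$: $A_d$ is the set of all $\alpha\in F_{n,m}$ with $\tau^d\alpha=\alpha$; $B_d$ is the set of all elements of $F_{n,m}$ whose $H$-orbit has length $d$; $\mathcal{D}(n,m,d)$ is the set of all $d'\in\mathcal{D}(n,m)$ that divide $d$ and satisfy $d'\ne d$; $\mathcal{D}_0(n,m,d)$ is the set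 of maximal elements of $\mathcal{D}(n,m,d)$ with respect to divisibility. *)

theory Defs
  imports
    "Jordan_Normal_Form.VS_Connect"
    "HOL-Algebra.Elementary_Groups"
    "HOL-Algebra.Group_Action"
    "HOL-Algebra.QuotRing"
    "HOL-Algebra.Sym_Groups"
begin

section \<open>Graded algebras\<close>

text \<open>An algebra over \<open>K\<close> is given by a \<open>module\<close> record, whose ring multiplication need not be
  commutative (the locale \<open>algebra\<close> of HOL-Algebra covers commutative algebras only).\<close>

definition internal_direct_sum ::
  "('k, 'a, 'c) module_scheme \<Rightarrow> 'i set \<Rightarrow> ('i \<Rightarrow> 'a set) \<Rightarrow> bool"
where
  "internal_direct_sum M I A \<longleftrightarrow>
    (\<forall>a\<in>carrier M. \<exists>!f. f \<in> (\<Pi>\<^sub>E i\<in>I. A i) \<and>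
       finite {i\<in>I. f i \<noteq> \<zero>\<^bsub>M\<^esub>} \<and> a = (\<Oplus>\<^bsub>M\<^esub>i\<in>{i\<in>I. f i \<noteq> \<zero>\<^bsub>M\<^esub>}. f i))"

text \<open>The family of components is required to be extensional, so that equal gradings are equal
  as functions; otherwise a grading would not be determined by its components.\<close>

definition is_grading ::
  "('k, 'r) ring_scheme \<Rightarrow> ('g, 'b) monoid_scheme \<Rightarrow> ('k, 'a, 'c) module_scheme
    \<Rightarrow> ('g \<Rightarrow> 'a set) \<Rightarrow> bool"
where
  "is_grading K G M A \<longleftrightarrow>
    A \<in> extensional (carrier G) \<and>
    (\<forall>g\<in>carrier G. subspace K (A g) M) \<and>
    internal_direct_sum M (carrier G) A \<and>
    (\<forall>g\<in>carrier G. \<forall>h\<in>carrier G. \<forall>x\<in>A g. \<forall>y\<in>A h. x \<otimes>\<^bsub>M\<^esub> y \<in> A (g \<otimes>\<^bsub>G\<^esub> h))"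

definition algebra_iso ::
  "('k, 'r) ring_scheme \<Rightarrow> ('k, 'a, 'c) module_scheme \<Rightarrow> ('k, 'b, 'd) module_scheme \<Rightarrow> ('a \<Rightarrow> 'b) set"
where
  "algebra_iso K M N =
    {f \<in> ring_iso M N. \<forall>c\<in>carrier K. \<forall>x\<in>carrier M. f (c \<odot>\<^bsub>M\<^esub> x) = c \<odot>\<^bsub>N\<^esub> f x}"

definition gradings_isomorphic ::
  "('k, 'r) ring_scheme \<Rightarrow> ('g, 'h) monoid_scheme \<Rightarrow> ('k, 'a, 'c) module_scheme
    \<Rightarrow> ('k, 'b, 'd) module_scheme \<Rightarrow> ('g \<Rightarrow> 'a set) \<Rightarrow> ('g \<Rightarrow> 'b set) \<Rightarrow> bool"
where
  "gradings_isomorphic K G M N A B \<longleftrightarrow>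
    (\<exists>f\<in>algebra_iso K M N. \<forall>g\<in>carrier G. f ` A g = B g)"

section \<open>Good gradings of matrix algebras\<close>

definition matrix_unit :: "nat \<Rightarrow> nat \<Rightarrow> nat \<Rightarrow> 'k::field mat" where
  "matrix_unit m i j = mat m m (\<lambda>(a, b). if a = i \<and> b = j then 1 else 0)"

definition good_gradings ::
  "'k::field itself \<Rightarrow> ('g, 'b) monoid_scheme \<Rightarrow> nat \<Rightarrow> ('g \<Rightarrow> 'k mat set) set"
where
  "good_gradings ty G m =
    {A. is_grading (class_ring :: 'k ring) G (module_mat TYPE('k) m m) A \<and>
        (\<forall>i<m. \<forall>j<m. \<exists>g\<in>carrier G. matrix_unit m i j \<in> A g)}"

definition good_grading_types ::
  "'k::field itself \<Rightarrow> ('g, 'b) monoid_scheme \<Rightarrow> nat \<Rightarrow> ('g \<Rightarrow> 'k mat set) set set"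
where
  "good_grading_types ty G m =
    good_gradings ty G m //
      {(A, B). A \<in> good_gradings ty G m \<and> B \<in> good_gradings ty G m \<and>
         gradings_isomorphic (class_ring :: 'k ring) G
           (module_mat TYPE('k) m m) (module_mat TYPE('k) m m) A B}"

section \<open>Tuples and cyclic shifts\<close>

text \<open>A tuple \<open>(k\<^sub>0, \<dots>, k\<^sub>n\<^sub>-\<^sub>1)\<close> is an extensional function on the positions \<open>{1..n}\<close> moved by
  \<open>sym_group n\<close>; its value at \<open>i\<close> is \<open>k\<^sub>i\<^sub>-\<^sub>1\<close>.\<close>

definition F_set :: "nat \<Rightarrow> nat \<Rightarrow> (nat \<Rightarrow> nat) set" where
  "F_set n m = {\<alpha> \<in> {1..n} \<rightarrow>\<^sub>E UNIV. (\<Sum>i\<in>{1..n}. \<alpha> i) = m}"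

definition tau :: "nat \<Rightarrow> nat \<Rightarrow> nat" where
  "tau n = cycle_of_list [1..<Suc n]"

definition H_group :: "nat \<Rightarrow> (nat \<Rightarrow> nat) monoid" where
  "H_group n = (sym_group n)\<lparr>carrier := generate (sym_group n) {tau n}\<rparr>"

text \<open>The entry at position \<open>i\<close> is moved to position \<open>\<sigma> i\<close>.\<close>

definition tuple_act :: "(nat \<Rightarrow> nat) \<Rightarrow> (nat \<Rightarrow> nat) \<Rightarrow> (nat \<Rightarrow> nat)" where
  "tuple_act \<sigma> \<alpha> = \<alpha> \<circ> inv_into UNIV \<sigma>"

definition D_set :: "nat \<Rightarrow> nat \<Rightarrow> nat set" where
  "D_set n m = {d. 0 < d \<and> d dvd n \<and> n div d dvd m}"

definition A_set :: "nat \<Rightarrow> nat \<Rightarrow> nat \<Rightarrow> (nat \<Rightarrow> nat) set" where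
  "A_set n m d = {\<alpha> \<in> F_set n m. tuple_act (tau n ^^ d) \<alpha> = \<alpha>}"

definition B_set :: "nat \<Rightarrow> nat \<Rightarrow> nat \<Rightarrow> (nat \<Rightarrow> nat) set" where
  "B_set n m d = {\<alpha> \<in> F_set n m. card (orbit (H_group n) tuple_act \<alpha>) = d}"

definition D_sub :: "nat \<Rightarrow> nat \<Rightarrow> nat \<Rightarrow> nat set" where
  "D_sub n m d = {d' \<in> D_set n m. d' dvd d \<and> d' \<noteq> d}"

definition D_max :: "nat \<Rightarrow> nat \<Rightarrow> nat \<Rightarrow> nat set" where
  "D_max n m d = {d' \<in> D_sub n m d. \<forall>e\<in>D_sub n m d. d' dvd e \<longrightarrow> e = d'}"

end

theory Submission
  imports "HOL-Algebra.Multiplicative_Group" Defs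
begin

text \<open>
  A good grading of the matrix algebra is determined by the degrees \<open>d i j\<close> of the matrix units,
  because every component is spanned by the matrix units that it contains, and the functions
  \<open>d\<close> that occur are exactly those with \<open>d i j \<cdot> d j k = d i k\<close>
  (\<open>degree_grading_good\<close>, \<open>good_grading_is_degree_grading\<close>).
  Such a function is recovered from any of its columns.  For a cyclic group generated by \<open>a\<close>,
  counting how often each power of \<open>a\<close> occurs in column \<open>j\<close> gives a tuple in \<open>F_set n m\<close>, the
  weight tuple; passing to another column multiplies all entries of the column by one power
  \<open>a\<^sup>k\<close>, which shifts the tuple cyclically.  So a grading determines an orbit of tuples.

  Two gradings with the same orbit are isomorphic: up to a permutation of the indices their degree
  functions coincide, and permuting rows and columns simultaneously is an automorphism
  (\<open>permuted_degrees_isomorphic\<close>).  The converse must deal with an arbitrary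
  isomorphism \<open>\<phi>\<close>.  Some column \<open>j\<close> of \<open>\<phi> e\<^sub>0\<^sub>0\<close> is nonzero, and then the \<open>j\<close>-th columns of the
  matrices \<open>\<phi> e\<^sub>i\<^sub>0\<close> are linearly independent.  They form an invertible matrix, whose
  determinant has a nonvanishing term, that is, a permutation \<open>p\<close> such that \<open>\<phi> e\<^sub>p\<^sub>i\<^sub>,\<^sub>0\<close> has a nonzero
  entry at \<open>(i, j)\<close> for every \<open>i\<close>.  As \<open>\<phi> e\<^sub>p\<^sub>i\<^sub>,\<^sub>0\<close> is homogeneous, \<open>e\<^sub>i\<^sub>j\<close> has in the second grading
  the degree that \<open>e\<^sub>p\<^sub>i\<^sub>,\<^sub>0\<close> has in the first (\<open>isomorphic_degrees_permuted\<close>), so a column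
  of either grading has the same weight tuple.  Since every tuple occurs, the isomorphism types
  correspond to the orbits of \<open>F_set n m\<close> (\<open>card_good_grading_types\<close>).

  It remains to count orbits.  An orbit of length \<open>d\<close> contributes \<open>d\<close> tuples to \<open>B_set n m d\<close>,
  and the length is the least period of its tuples, which lies in \<open>D_set n m\<close> because a
  tuple with period \<open>d\<close> consists of \<open>n / d\<close> copies of one block.  A tuple is fixed by the
  \<open>d\<close>-th power of the shift iff its least period divides \<open>d\<close>; this expresses \<open>B_set\<close> through the sets
  \<open>A_set\<close> (\<open>card_B_set\<close>).
\<close>

section \<open>Orbits of iterates and counting classes\<close>

text \<open>Up to the least period \<open>p\<close> the iterates are distinct: from \<open>f\<^sup>i x = f\<^sup>j x\<close> with \<open>i < j < p\<close> one would
  obtain the smaller period \<open>p - j + i\<close>.\<close>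

lemma card_range_funpow:
  assumes "(f ^^ n) x = x" "n > 0"
  shows "card (range (\<lambda>k. (f ^^ k) x)) = least_power f x"
proof -
  define p where "p = least_power f x"
  have p: "(f ^^ p) x = x" "p > 0"
    using least_powerI[OF assms] by (auto simp: p_def)
  have "range (\<lambda>k. (f ^^ k) x) = (\<lambda>k. (f ^^ k) x) ` {..<p}"
  proof -
    have "(f ^^ k) x = (f ^^ (k mod p)) x" for k
      using funpow_mod_eq[OF p(1)] by simp
    then show ?thesis
      using p(2) by (auto simp: image_iff) (metis lessThan_iff mod_less_divisor)
  qed
  moreover have "inj_on (\<lambda>k. (f ^^ k) x) {..<p}"
  proof (rule linorder_inj_onI')
    fix i j assume ij: "i \<in> {..<p}" "j \<in> {..<p}" "i < j"
    show "(f ^^ i) x \<noteq> (f ^^ j) x"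
    proof
      assume "(f ^^ i) x = (f ^^ j) x"
      then have "(f ^^ (p - j + i)) x = (f ^^ (p - j + j)) x"
        by (simp add: funpow_add)
      also have "\<dots> = x" using ij p by simp
      finally have "p \<le> p - j + i"
        using least_power_le[of "p - j + i" f x] ij by (simp add: p_def)
      then show False using ij by simp
    qed
  qed
  ultimately show ?thesis by (simp add: card_image p_def)
qed

lemma funpow_fixes_iff_least_power_dvd:
  assumes "(f ^^ n) x = x" "n > 0"
  shows "(f ^^ k) x = x \<longleftrightarrow> least_power f x dvd k"
proof
  assume "least_power f x dvd k"
  then show "(f ^^ k) x = x"
    using funpow_mod_eq[OF least_powerI(1)[OF assms], of k] by (simp add: dvd_eq_mod_eq_0)
qed (rule least_power_minimal)

text \<open>Going on from \<open>f\<^sup>j x\<close> one gets back to \<open>x\<close>, as \<open>n j \<ge> j\<close> steps from \<open>x\<close> lead to \<open>x\<close>.\<close>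

lemma range_funpow_shift:
  assumes "(f ^^ n) x = x" "n > 0"
  shows "range (\<lambda>k. (f ^^ k) ((f ^^ j) x)) = range (\<lambda>k. (f ^^ k) x)"
proof -
  have "(f ^^ k) x \<in> range (\<lambda>k. (f ^^ k) ((f ^^ j) x))" for k
  proof -
    have "(f ^^ (n * j)) x = x"
      using assms funpow_mod_eq[OF assms(1), of "n * j"] by simp
    then have "(f ^^ k) x = (f ^^ (k + n * j)) x"
      by (simp only: funpow_add o_apply)
    also have "k + n * j = k + (n * j - j) + j"
      using assms(2) by (cases n) simp_all
    finally have "(f ^^ k) x = (f ^^ (k + (n * j - j) + j)) x" .
    then have "(f ^^ k) x = (f ^^ (k + (n * j - j))) ((f ^^ j) x)"
      by (simp only: funpow_add o_apply)
    then show ?thesis by blast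
  qed
  moreover have "(f ^^ k) ((f ^^ j) x) \<in> range (\<lambda>k. (f ^^ k) x)" for k
    by (metis comp_apply funpow_add rangeI)
  ultimately show ?thesis by blast
qed

text \<open>Every class \<open>c\<close> contributes \<open>card c\<close> summands \<open>1 / card c\<close>.\<close>

lemma card_classes_eq_sum_inverse:
  assumes "finite X" "\<And>x. x \<in> X \<Longrightarrow> x \<in> C x" "\<And>x. x \<in> X \<Longrightarrow> C x \<subseteq> X"
    "\<And>x y. x \<in> X \<Longrightarrow> y \<in> C x \<Longrightarrow> C y = C x"
  shows "real (card (C ` X)) = (\<Sum>x\<in>X. 1 / real (card (C x)))"
proof -
  have "(\<Sum>x\<in>X. 1 / real (card (C x))) = (\<Sum>c\<in>C ` X. \<Sum>x\<in>{x\<in>X. C x = c}. 1 / real (card (C x)))"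
    by (rule sum.image_gen[OF assms(1)])
  also have "\<dots> = (\<Sum>c\<in>C ` X. 1)"
  proof (rule sum.cong[OF refl])
    fix c assume c: "c \<in> C ` X"
    then obtain y where y: "y \<in> X" "c = C y" by blast
    have eq: "{x\<in>X. C x = c} = c"
    proof
      show "{x\<in>X. C x = c} \<subseteq> c" using assms(2) by auto
      show "c \<subseteq> {x\<in>X. C x = c}" using assms(3)[OF y(1)] assms(4)[OF y(1)] y(2) by auto
    qed
    have "c \<noteq> {}" using assms(2)[OF y(1)] y(2) by auto
    have "finite c" using assms(3)[OF y(1)] assms(1) y(2) by (auto intro: finite_subset)
    have "(\<Sum>x\<in>{x\<in>X. C x = c}. 1 / real (card (C x))) = (\<Sum>x\<in>{x\<in>X. C x = c}. 1 / real (card c))"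
      by (rule sum.cong) auto
    also have "\<dots> = 1" using \<open>c \<noteq> {}\<close> \<open>finite c\<close> by (simp add: eq)
    finally show "(\<Sum>x\<in>{x\<in>X. C x = c}. 1 / real (card (C x))) = 1" .
  qed
  finally show ?thesis by simp
qed

text \<open>A relation on \<open>X\<close> that is the kernel of an invariant \<open>g\<close> has one class for each value of \<open>g\<close>.
  Such an invariant makes the relation an equivalence and counts its classes at the same time.\<close>

lemma card_quotient_of_kernel:
  assumes "\<And>x y. x \<in> X \<Longrightarrow> y \<in> X \<Longrightarrow> R x y \<longleftrightarrow> g x = g y"
  shows "card (X // {(x, y). x \<in> X \<and> y \<in> X \<and> R x y}) = card (g ` X)"
proof -
  let ?h = "\<lambda>v. {y \<in> X. g y = v}"
  have "X // {(x, y). x \<in> X \<and> y \<in> X \<and> R x y} = (\<lambda>x. ?h (g x)) ` X"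
  proof -
    have "{(x, y). x \<in> X \<and> y \<in> X \<and> R x y} `` {x} = ?h (g x)" if "x \<in> X" for x
      using assms that by auto
    then show ?thesis by (auto simp: quotient_def)
  qed
  also have "\<dots> = ?h ` (g ` X)" by auto
  moreover have "inj_on ?h (g ` X)" by (auto simp: inj_on_def)
  ultimately show ?thesis by (simp add: card_image)
qed

section \<open>Cyclic shifts of tuples\<close>

lemma tau_permutes: "tau n permutes {1..n}"
proof -
  have "set [1..<Suc n] = {1..n}" by auto
  then show ?thesis unfolding tau_def using cycle_permutes[of "[1..<Suc n]"] by simp
qed

text \<open>On positions starting at 1 the shift is addition modulo \<open>n\<close> only after passing to \<open>i - 1\<close>.\<close>

lemma tau_funpow:
  assumes "i \<in> {1..n}"
  shows "(tau n ^^ k) i = (i - 1 + k) mod n + 1"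
proof -
  have d: "cycle [1..<Suc n]" by simp
  have "map (tau n ^^ k) [1..<Suc n] ! (i - 1) = rotate k [1..<Suc n] ! (i - 1)"
    unfolding tau_def by (simp only: cyclic_rotation[OF d])
  moreover have "map (tau n ^^ k) [1..<Suc n] ! (i - 1) = (tau n ^^ k) i"
    using assms by (subst nth_map) (auto simp del: upt_Suc)
  moreover have "rotate k [1..<Suc n] ! (i - 1) = (i - 1 + k) mod n + 1"
    using assms by (subst nth_rotate) (auto simp: add.commute simp del: upt_Suc)
  ultimately show ?thesis by simp
qed

lemma tau_funpow_n: "tau n ^^ n = id"
  using cycle_is_id_root[of "[1..<Suc n]"] by (simp add: tau_def del: upt_Suc)

lemma tau_funpow_permutes: "tau n ^^ k permutes {1..n}"
  by (rule permutes_funpow[OF tau_permutes])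

lemma tuple_act_funpow: "tuple_act (tau n ^^ k) = tuple_act (tau n) ^^ k"
proof (induction k)
  case 0
  then show ?case by (simp add: tuple_act_def fun_eq_iff)
next
  case (Suc k)
  have "inv_into UNIV (tau n ^^ Suc k) = inv_into UNIV (tau n ^^ k) \<circ> inv_into UNIV (tau n)"
    using o_inv_distrib[OF permutes_bij[OF tau_permutes] permutes_bij[OF tau_funpow_permutes]] by simp
  then have "tuple_act (tau n ^^ Suc k) = tuple_act (tau n) \<circ> tuple_act (tau n ^^ k)"
    by (simp only: tuple_act_def fun_eq_iff o_apply) simp
  then show ?case by (simp only: Suc funpow.simps)
qed

lemma tuple_act_tau_n: "(tuple_act (tau n) ^^ n) \<alpha> = \<alpha>"
  by (simp flip: tuple_act_funpow add: tau_funpow_n tuple_act_def)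

text \<open>Since \<open>tau n\<close> has finite order, nonnegative powers suffice.\<close>

lemma generate_tau:
  assumes "n > 0"
  shows "generate (sym_group n) {tau n} = range (\<lambda>k. tau n ^^ k)"
proof
  have inv_tau: "inv\<^bsub>sym_group n\<^esub> (tau n) = tau n ^^ (n - 1)"
  proof -
    have "tau n ^^ (n - 1) \<circ> tau n = id"
      by (metis Suc_diff_1 assms funpow_Suc_right tau_funpow_n)
    then show ?thesis
      using group.inv_equality[OF sym_group_is_group[of n], of "tau n ^^ (n - 1)" "tau n"]
        tau_permutes tau_funpow_permutes
      by (simp add: sym_group_def)
  qed
  show "generate (sym_group n) {tau n} \<subseteq> range (\<lambda>k. tau n ^^ k)"
  proof
    fix s assume "s \<in> generate (sym_group n) {tau n}"
    then show "s \<in> range (\<lambda>k. tau n ^^ k)"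
    proof induction
      case one
      then show ?case by (auto simp: sym_group_one intro!: image_eqI[of _ _ 0])
    next
      case (incl h)
      then show ?case by (auto intro!: image_eqI[of _ _ 1])
    next
      case (inv h)
      then show ?case using inv_tau by auto
    next
      case (eng h1 h2)
      then obtain i j where "h1 = tau n ^^ i" "h2 = tau n ^^ j" by blast
      then have "h1 \<otimes>\<^bsub>sym_group n\<^esub> h2 = tau n ^^ (i + j)"
        by (simp add: sym_group_mult funpow_add)
      then show ?case by simp
    qed
  qed
  show "range (\<lambda>k. tau n ^^ k) \<subseteq> generate (sym_group n) {tau n}"
  proof safe
    fix k
    show "tau n ^^ k \<in> generate (sym_group n) {tau n}"
    proof (induction k)
      case 0
      then show ?case using generate.one[of "sym_group n" "{tau n}"] by (simp add: sym_group_one id_def)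
    next
      case (Suc k)
      then show ?case
        using generate.eng[OF generate.incl[of "tau n" "{tau n}" "sym_group n"] Suc]
        by (simp only: sym_group_mult funpow.simps singletonI simp_thms)
    qed
  qed
qed

lemma orbit_H_group:
  assumes "n > 0"
  shows "orbit (H_group n) tuple_act \<alpha> = range (\<lambda>k. (tuple_act (tau n) ^^ k) \<alpha>)"
  unfolding orbit_def H_group_def by (auto simp: generate_tau[OF assms] tuple_act_funpow) (metis rangeI tuple_act_funpow)

text \<open>The entry at \<open>i\<close> moves to position \<open>\<tau>\<^sup>k i\<close>; evaluating at positions of this form avoids inverse
  permutations.\<close>

lemma tuple_act_funpow_apply:
  "(tuple_act (tau n) ^^ k) \<alpha> ((tau n ^^ k) i) = \<alpha> i"
  by (simp flip: tuple_act_funpow add: tuple_act_def permutes_inverses[OF tau_funpow_permutes])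

lemma tuple_act_F_set:
  assumes "\<alpha> \<in> F_set n m"
  shows "(tuple_act (tau n) ^^ k) \<alpha> \<in> F_set n m"
proof -
  let ?q = "inv_into UNIV (tau n ^^ k)"
  have q: "?q permutes {1..n}" by (rule permutes_inv[OF tau_funpow_permutes])
  have "(\<Sum>i\<in>{1..n}. \<alpha> (?q i)) = (\<Sum>i\<in>{1..n}. \<alpha> i)"
    using sum.permute[OF q, of \<alpha>] by (simp add: o_def)
  moreover have "\<alpha> (?q i) = undefined" if "i \<notin> {1..n}" for i
    using assms that permutes_not_in[OF q that] by (auto simp: F_set_def PiE_def extensional_def)
  ultimately show ?thesis
    using assms by (auto simp: F_set_def PiE_def extensional_def tuple_act_def simp flip: tuple_act_funpow)
qed

lemma finite_F_set: "finite (F_set n m)"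
proof (rule finite_subset)
  show "F_set n m \<subseteq> {1..n} \<rightarrow>\<^sub>E {..m}"
    by (auto simp: F_set_def PiE_def Pi_def intro!: member_le_sum)
qed (auto intro: finite_PiE)

lemma sum_periodic:
  fixes f :: "nat \<Rightarrow> nat"
  assumes "\<And>i. f (i + p) = f i"
  shows "(\<Sum>i<q * p. f i) = q * (\<Sum>i<p. f i)"
proof -
  have shift: "f (i + k * p) = f i" for i k
    by (induction k) (simp_all add: assms add.assoc[symmetric], metis assms add.assoc add.commute)
  have "(\<Sum>i<q * p. f i) = (\<Sum>k<q. \<Sum>i=k * p..<k * p + p. f i)"
    by (rule sum.nat_group[symmetric])
  also have "\<dots> = (\<Sum>k<q. \<Sum>i<p. f i)"
  proof (rule sum.cong[OF refl])
    fix k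
    show "(\<Sum>i=k * p..<k * p + p. f i) = (\<Sum>i<p. f i)"
      using sum.shift_bounds_nat_ivl[of f 0 "k * p" p] shift
      by (simp add: add.commute lessThan_atLeast0)
  qed
  finally show ?thesis by simp
qed

definition tuple_period :: "nat \<Rightarrow> (nat \<Rightarrow> nat) \<Rightarrow> nat" where
  "tuple_period n = least_power (tuple_act (tau n))"

lemma card_orbit_eq_tuple_period:
  assumes "n > 0"
  shows "card (orbit (H_group n) tuple_act \<alpha>) = tuple_period n \<alpha>"
  unfolding orbit_H_group[OF assms] tuple_period_def
  by (rule card_range_funpow[OF tuple_act_tau_n assms])

lemma fixed_iff_tuple_period_dvd:
  assumes "n > 0"
  shows "(tuple_act (tau n) ^^ d) \<alpha> = \<alpha> \<longleftrightarrow> tuple_period n \<alpha> dvd d"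
  unfolding tuple_period_def by (rule funpow_fixes_iff_least_power_dvd[OF tuple_act_tau_n assms])

text \<open>A tuple of period \<open>p\<close> consists of \<open>n / p\<close> copies of one block, so its sum \<open>m\<close> is \<open>n / p\<close> times the
  sum of the block.\<close>

lemma tuple_period_in_D_set:
  assumes "n > 0" "\<alpha> \<in> F_set n m"
  shows "tuple_period n \<alpha> \<in> D_set n m"
proof -
  define p where "p = tuple_period n \<alpha>"
  have p0: "p > 0"
    unfolding p_def tuple_period_def by (rule least_powerI(2)[OF tuple_act_tau_n assms(1)])
  have pn: "p dvd n"
    using fixed_iff_tuple_period_dvd[OF assms(1), of n \<alpha>] tuple_act_tau_n by (simp add: p_def)
  have fix_p: "(tuple_act (tau n) ^^ p) \<alpha> = \<alpha>"
    using fixed_iff_tuple_period_dvd[OF assms(1), of p \<alpha>] by (simp add: p_def)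
  \<comment> \<open>The periodic extension of the tuple to all of \<open>nat\<close>, with positions starting at 0.\<close>
  define b where "b i = \<alpha> (i mod n + 1)" for i
  have per: "b (i + p) = b i" for i
  proof -
    have "\<alpha> ((tau n ^^ p) (i mod n + 1)) = \<alpha> (i mod n + 1)"
      using tuple_act_funpow_apply[of p n \<alpha> "i mod n + 1"] fix_p by simp
    moreover have "(tau n ^^ p) (i mod n + 1) = (i + p) mod n + 1"
      using tau_funpow[of "i mod n + 1" n p] assms(1) by (simp add: mod_add_left_eq Suc_leI)
    ultimately show ?thesis by (simp add: b_def)
  qed
  have "m = (\<Sum>i\<in>{1..n}. \<alpha> i)" using assms by (simp add: F_set_def)
  also have "\<dots> = (\<Sum>i<n. \<alpha> (Suc i))" by (simp add: sum.atLeast1_atMost_eq)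
  also have "\<dots> = (\<Sum>i<n. b i)" by (rule sum.cong) (auto simp: b_def)
  also have "\<dots> = (\<Sum>i<(n div p) * p. b i)" using pn by simp
  also have "\<dots> = (n div p) * (\<Sum>i<p. b i)" using per by (rule sum_periodic)
  finally have "n div p dvd m" by simp
  then show ?thesis using p0 pn by (simp add: D_set_def flip: p_def)
qed

text \<open>Each tuple is weighted with the inverse length of its orbit, and the tuples are then grouped
  by this length.\<close>

lemma card_orbits_F_set:
  assumes "n > 0"
  shows "real (card (orbit (H_group n) tuple_act ` F_set n m))
       = (\<Sum>d\<in>D_set n m. 1 / real d * real (card (B_set n m d)))"
proof -
  let ?O = "orbit (H_group n) tuple_act"
  have "real (card (?O ` F_set n m)) = (\<Sum>\<alpha>\<in>F_set n m. 1 / real (card (?O \<alpha>)))"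
  proof (rule card_classes_eq_sum_inverse[OF finite_F_set])
    fix \<alpha> assume \<alpha>: "\<alpha> \<in> F_set n m"
    show "\<alpha> \<in> ?O \<alpha>" by (auto simp: orbit_H_group[OF assms] intro: image_eqI[of _ _ 0])
    show "?O \<alpha> \<subseteq> F_set n m" using tuple_act_F_set[OF \<alpha>] by (auto simp: orbit_H_group[OF assms])
    show "?O \<beta> = ?O \<alpha>" if "\<beta> \<in> ?O \<alpha>" for \<beta>
    proof -
      from that obtain j where "\<beta> = (tuple_act (tau n) ^^ j) \<alpha>"
        unfolding orbit_H_group[OF assms] by blast
      then show ?thesis
        unfolding orbit_H_group[OF assms] by (simp only: range_funpow_shift[OF tuple_act_tau_n assms])
    qed
  qed
  also have "\<dots> = (\<Sum>d\<in>D_set n m. \<Sum>\<alpha>\<in>{\<alpha>\<in>F_set n m. card (?O \<alpha>) = d}. 1 / real (card (?O \<alpha>)))"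
  proof (rule sum.group[symmetric, OF finite_F_set])
    show "finite (D_set n m)"
      using assms by (auto simp: D_set_def dvd_imp_le intro: finite_subset[of _ "{..n}"])
    show "(\<lambda>\<alpha>. card (?O \<alpha>)) ` F_set n m \<subseteq> D_set n m"
      using tuple_period_in_D_set[OF assms] by (auto simp: card_orbit_eq_tuple_period[OF assms])
  qed
  also have "\<dots> = (\<Sum>d\<in>D_set n m. 1 / real d * real (card (B_set n m d)))"
    by (rule sum.cong[OF refl]) (simp add: B_set_def mult.commute)
  finally show ?thesis .
qed

text \<open>In terms of the least period \<open>p\<close>, membership in \<open>A_set n m d\<close> means \<open>p dvd d\<close> and membership in \<open>B_set n m d\<close>
  means \<open>p = d\<close>.  If \<open>p\<close> is a proper divisor of \<open>d\<close>, then it lies in \<open>D_sub n m d\<close> and therefore divides a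
  maximal element of this finite set.\<close>

lemma card_B_set:
  assumes "n > 0" "d \<in> D_set n m"
  shows "real (card (B_set n m d))
       = real (card (A_set n m d)) - real (card (\<Union>d'\<in>D_max n m d. A_set n m d'))"
proof -
  let ?U = "\<Union>d'\<in>D_max n m d. A_set n m d'"
  have A: "A_set n m e = {\<alpha>\<in>F_set n m. tuple_period n \<alpha> dvd e}" for e
    by (simp add: A_set_def tuple_act_funpow fixed_iff_tuple_period_dvd[OF assms(1)])
  have B: "B_set n m d = {\<alpha>\<in>F_set n m. tuple_period n \<alpha> = d}"
    by (simp add: B_set_def card_orbit_eq_tuple_period[OF assms(1)])
  have d0: "d > 0" using assms by (simp add: D_set_def)
  have below_max: "\<exists>d'\<in>D_max n m d. e dvd d'" if "e \<in> D_sub n m d" for e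
  proof -
    have fin: "finite (D_sub n m d)"
      using d0 by (auto simp: D_sub_def dvd_imp_le intro: finite_subset[of _ "{..d}"])
    let ?S = "{e' \<in> D_sub n m d. e dvd e'}"
    have "finite ?S" "?S \<noteq> {}" using fin that by auto
    then have mx: "Max ?S \<in> ?S" by (rule Max_in)
    have "Max ?S \<in> D_max n m d"
      unfolding D_max_def
    proof (intro CollectI conjI ballI impI)
      show "Max ?S \<in> D_sub n m d" using mx by simp
      fix e' assume e': "e' \<in> D_sub n m d" "Max ?S dvd e'"
      then have "e' \<in> ?S" using mx by (auto intro: dvd_trans)
      then have "e' \<le> Max ?S" using \<open>finite ?S\<close> by simp
      moreover have "0 < e'" using e' by (simp add: D_sub_def D_set_def)
      then have "Max ?S \<le> e'" using e' by (simp add: dvd_imp_le)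
      ultimately show "e' = Max ?S" by simp
    qed
    then show ?thesis using mx by blast
  qed
  have "A_set n m d - B_set n m d = ?U"
  proof
    show "A_set n m d - B_set n m d \<subseteq> ?U"
    proof
      fix \<alpha> assume \<alpha>: "\<alpha> \<in> A_set n m d - B_set n m d"
      then have "tuple_period n \<alpha> \<in> D_sub n m d"
        using tuple_period_in_D_set[OF assms(1)] by (auto simp: A B D_sub_def)
      then show "\<alpha> \<in> ?U" using below_max \<alpha> by (auto simp: A)
    qed
    show "?U \<subseteq> A_set n m d - B_set n m d"
      by (auto simp: A B D_max_def D_sub_def intro: dvd_trans dvd_antisym)
  qed
  moreover have "B_set n m d \<subseteq> A_set n m d" by (auto simp: A B)
  moreover have "finite (A_set n m d)" using finite_F_set by (simp add: A)
  ultimately have "card ?U = card (A_set n m d) - card (B_set n m d)"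
    "card (B_set n m d) \<le> card (A_set n m d)"
    using card_Diff_subset[of "B_set n m d" "A_set n m d"] card_mono[of "A_set n m d" "B_set n m d"]
    by (auto intro: finite_subset)
  then show ?thesis by (simp add: of_nat_diff)
qed

section \<open>Good gradings and degree functions\<close>

definition degree_component :: "nat \<Rightarrow> (nat \<Rightarrow> nat \<Rightarrow> 'g) \<Rightarrow> 'g \<Rightarrow> 'k::field mat set" where
  "degree_component m d g =
    {x \<in> carrier_mat m m. \<forall>i<m. \<forall>j<m. x $$ (i, j) \<noteq> 0 \<longrightarrow> d i j = g}"

definition degree_grading ::
  "('g, 'b) monoid_scheme \<Rightarrow> nat \<Rightarrow> (nat \<Rightarrow> nat \<Rightarrow> 'g) \<Rightarrow> 'g \<Rightarrow> 'k::field mat set" where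
  "degree_grading G m d = restrict (degree_component m d) (carrier G)"

text \<open>Over a group these are the functions \<open>d i j = w i \<cdot> (w j)\<^sup>-\<^sup>1\<close>.  Unlike the weights \<open>w\<close>, the
  function \<open>d\<close> is determined by the grading.\<close>

definition degree_function ::
  "('g, 'b) monoid_scheme \<Rightarrow> nat \<Rightarrow> (nat \<Rightarrow> nat \<Rightarrow> 'g) \<Rightarrow> bool" where
  "degree_function G m d \<longleftrightarrow>
    (\<forall>i<m. \<forall>j<m. d i j \<in> carrier G) \<and>
    (\<forall>i<m. \<forall>j<m. \<forall>k<m. d i j \<otimes>\<^bsub>G\<^esub> d j k = d i k)"

lemma matrix_unit_carrier [simp]: "matrix_unit m i j \<in> carrier_mat m m"
  by (simp add: matrix_unit_def)

lemma matrix_unit_index [simp]: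
  "a < m \<Longrightarrow> b < m \<Longrightarrow> matrix_unit m i j $$ (a, b) = (if a = i \<and> b = j then 1 else 0)"
  by (simp add: matrix_unit_def)

lemma matrix_unit_in_degree_component [simp]:
  "i < m \<Longrightarrow> j < m \<Longrightarrow> matrix_unit m i j \<in> degree_component m d g \<longleftrightarrow> d i j = g"
  by (auto simp: degree_component_def)

lemma degree_component_index_eq_0:
  "x \<in> degree_component m d g \<Longrightarrow> i < m \<Longrightarrow> j < m \<Longrightarrow> d i j \<noteq> g \<Longrightarrow> x $$ (i, j) = 0"
  unfolding degree_component_def by blast

lemma index_mult_mat_sum:
  "A \<in> carrier_mat m m \<Longrightarrow> B \<in> carrier_mat m m \<Longrightarrow> i < m \<Longrightarrow> j < m \<Longrightarrow>
    (A * B) $$ (i, j) = (\<Sum>k<m. A $$ (i, k) * B $$ (k, j))"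
  by (auto simp: scalar_prod_def lessThan_atLeast0 intro!: sum.cong)

lemma matrix_unit_mult:
  assumes "i < m" "j < m" "k < m"
  shows "matrix_unit m i j * matrix_unit m j k = (matrix_unit m i k :: 'k::field mat)"
proof (rule eq_matI)
  fix a b assume "a < dim_row (matrix_unit m i k :: 'k mat)" "b < dim_col (matrix_unit m i k :: 'k mat)"
  then have ab: "a < m" "b < m" by (simp_all add: matrix_unit_def)
  have "(\<Sum>l<m. (if a = i \<and> l = j then 1 else 0) * (if l = j \<and> b = k then 1 else 0 :: 'k))
      = (\<Sum>l<m. if l = j then (if a = i \<and> b = k then 1 else 0) else 0)"
    by (rule sum.cong) auto
  then show "(matrix_unit m i j * matrix_unit m j k) $$ (a, b) = (matrix_unit m i k :: 'k mat) $$ (a, b)"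
    using ab assms by (simp add: index_mult_mat_sum[of _ m])
qed (simp_all add: matrix_unit_def)

lemma index_finsum_mat:
  assumes "finite S" "\<And>s. s \<in> S \<Longrightarrow> f s \<in> carrier_mat m m" "a < m" "b < m"
  shows "(\<Oplus>\<^bsub>module_mat TYPE('k::field) m m\<^esub>s\<in>S. f s) $$ (a, b) = (\<Sum>s\<in>S. f s $$ (a, b))"
proof -
  interpret abelian_group "module_mat TYPE('k) m m" by (rule abelian_group_mat)
  show ?thesis using assms(1,2)
  proof (induction S)
    case empty
    then show ?case using assms by (simp add: module_mat_simps)
  next
    case (insert s S)
    have "(\<Oplus>\<^bsub>module_mat TYPE('k) m m\<^esub>s\<in>S. f s) \<in> carrier_mat m m"
      using finsum_closed[of f S] insert.prems by (auto simp: module_mat_simps)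
    then show ?case
      using insert assms by (subst finsum_insert) (auto simp: module_mat_simps)
  qed
qed

lemma finsum_mat_carrier:
  assumes "\<And>s. s \<in> S \<Longrightarrow> f s \<in> carrier_mat m m"
  shows "(\<Oplus>\<^bsub>module_mat TYPE('k::field) m m\<^esub>s\<in>S. f s) \<in> carrier_mat m m"
proof -
  interpret abelian_group "module_mat TYPE('k) m m" by (rule abelian_group_mat)
  show ?thesis using finsum_closed[of f S] assms by (auto simp: module_mat_simps)
qed

text \<open>In a sum of homogeneous matrices, one for each degree, only the summand of degree \<open>d a b\<close> can
  be nonzero at the position \<open>(a, b)\<close>.\<close>

lemma index_finsum_degree_components:
  assumes d: "d a b \<in> I" and ab: "a < m" "b < m"
    and f: "\<And>g. g \<in> I \<Longrightarrow> f g \<in> degree_component m d g"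
    and fin: "finite {g\<in>I. f g \<noteq> 0\<^sub>m m m}"
  shows "(\<Oplus>\<^bsub>module_mat TYPE('k::field) m m\<^esub>g\<in>{g\<in>I. f g \<noteq> 0\<^sub>m m m}. f g) $$ (a, b)
       = f (d a b) $$ (a, b)"
proof -
  let ?S = "{g\<in>I. f g \<noteq> 0\<^sub>m m m}"
  have zero: "f g $$ (a, b) = 0" if "g \<in> I" "g \<noteq> d a b" for g
    using f[OF that(1)] that(2) ab by (auto simp: degree_component_def)
  have "(\<Oplus>\<^bsub>module_mat TYPE('k) m m\<^esub>g\<in>?S. f g) $$ (a, b) = (\<Sum>g\<in>?S. f g $$ (a, b))"
    using f by (intro index_finsum_mat[OF fin _ ab]) (auto simp: degree_component_def)
  also have "\<dots> = (\<Sum>g\<in>?S. if g = d a b then f (d a b) $$ (a, b) else 0)"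
    using zero by (intro sum.cong) auto
  also have "\<dots> = f (d a b) $$ (a, b)"
    using d ab fin by (subst sum.delta) auto
  finally show ?thesis .
qed

text \<open>The component of degree \<open>g\<close> of a matrix is obtained by deleting the entries at positions of
  other degrees, and \<open>index_finsum_degree_components\<close> shows that this is the only decomposition.\<close>

lemma internal_direct_sum_degree_components:
  assumes d: "\<And>i j. i < m \<Longrightarrow> j < m \<Longrightarrow> d i j \<in> I"
  shows "internal_direct_sum (module_mat TYPE('k::field) m m) I (degree_component m d)"
  unfolding internal_direct_sum_def
proof (intro ballI ex_ex1I conjI; (elim conjE)?)
  let ?M = "module_mat TYPE('k) m m"
  let ?supp = "\<lambda>f. {g\<in>I. f g \<noteq> \<zero>\<^bsub>?M\<^esub>}"
  fix x :: "'k mat" assume "x \<in> carrier ?M"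
  then have x: "x \<in> carrier_mat m m" by (simp add: module_mat_simps)
  define f where "f = (\<lambda>g\<in>I. mat m m (\<lambda>(i, j). if d i j = g then x $$ (i, j) else 0))"
  have f: "f \<in> (\<Pi>\<^sub>E g\<in>I. degree_component m d g)"
    by (auto simp: f_def degree_component_def)
  have fin: "finite (?supp f)"
  proof (rule finite_subset)
    show "?supp f \<subseteq> (\<lambda>(i, j). d i j) ` ({..<m} \<times> {..<m})"
    proof safe
      fix g assume "g \<in> I" "f g \<noteq> \<zero>\<^bsub>?M\<^esub>"
      moreover have "f g = 0\<^sub>m m m" if "\<And>i j. i < m \<Longrightarrow> j < m \<Longrightarrow> d i j \<noteq> g"
        using \<open>g \<in> I\<close> that by (intro eq_matI) (auto simp: f_def)
      ultimately show "g \<in> (\<lambda>(i, j). d i j) ` ({..<m} \<times> {..<m})"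
        by (auto simp: module_mat_simps)
    qed
  qed auto
  have "(\<Oplus>\<^bsub>?M\<^esub>g\<in>?supp f. f g) \<in> carrier_mat m m"
    using f by (intro finsum_mat_carrier) (auto simp: degree_component_def PiE_def Pi_def)
  then have "x = (\<Oplus>\<^bsub>?M\<^esub>g\<in>?supp f. f g)"
    using x f fin d
    by (intro eq_matI)
      (auto simp: module_mat_simps index_finsum_degree_components[where d = d] f_def PiE_def Pi_def)
  then show "\<exists>f. f \<in> (\<Pi>\<^sub>E g\<in>I. degree_component m d g) \<and> finite (?supp f)
      \<and> x = (\<Oplus>\<^bsub>?M\<^esub>g\<in>?supp f. f g)"
    using f fin by blast
next
  let ?M = "module_mat TYPE('k) m m"
  let ?supp = "\<lambda>f. {g\<in>I. f g \<noteq> \<zero>\<^bsub>?M\<^esub>}"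
  fix x :: "'k mat" and f f' :: "'a \<Rightarrow> 'k mat"
  assume f: "f \<in> (\<Pi>\<^sub>E g\<in>I. degree_component m d g)" "finite (?supp f)"
      "x = (\<Oplus>\<^bsub>?M\<^esub>g\<in>?supp f. f g)"
    and f': "f' \<in> (\<Pi>\<^sub>E g\<in>I. degree_component m d g)" "finite (?supp f')"
      "x = (\<Oplus>\<^bsub>?M\<^esub>g\<in>?supp f'. f' g)"
  have entry: "h (d a b) $$ (a, b) = x $$ (a, b)"
    if "h \<in> (\<Pi>\<^sub>E g\<in>I. degree_component m d g)" "finite (?supp h)"
      "x = (\<Oplus>\<^bsub>?M\<^esub>g\<in>?supp h. h g)" "a < m" "b < m" for h a b
  proof -
    have "h g \<in> degree_component m d g" if "g \<in> I" for g
      using \<open>h \<in> _\<close> that by auto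
    then show ?thesis
      using index_finsum_degree_components[where d = d, OF d[OF that(4,5)] that(4,5), of h] that(2,3)
      by (simp add: module_mat_simps)
  qed
  show "f = f'"
  proof (rule PiE_ext[OF f(1) f'(1)])
    fix g assume g: "g \<in> I"
    have fg: "f g \<in> degree_component m d g" "f' g \<in> degree_component m d g"
      using f(1) f'(1) g by auto
    show "f g = f' g"
    proof (rule eq_matI)
      fix a b assume "a < dim_row (f' g)" "b < dim_col (f' g)"
      then have ab: "a < m" "b < m" using fg by (auto simp: degree_component_def)
      show "f g $$ (a, b) = f' g $$ (a, b)"
      proof (cases "d a b = g")
        case True
        then show ?thesis using entry[OF f ab] entry[OF f' ab] by simp
      next
        case False
        then show ?thesis using fg ab by (simp add: degree_component_index_eq_0)
      qed
    qed (use fg in \<open>auto simp: degree_component_def\<close>)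
  qed
qed

lemma subspace_degree_component:
  "subspace class_ring (degree_component m d g) (module_mat TYPE('k::field) m m)"
proof -
  interpret vectorspace "class_ring :: 'k ring" "module_mat TYPE('k) m m" by (rule matrix_vs)
  show ?thesis
  proof (intro subspace.intro submodule.intro)
    show "vectorspace class_ring (module_mat TYPE('k) m m)" by (rule matrix_vs)
    show "module class_ring (module_mat TYPE('k) m m)" by unfold_locales
    fix v w :: "'k mat" assume vw: "v \<in> degree_component m d g" "w \<in> degree_component m d g"
    have "v $$ (i, j) + w $$ (i, j) = 0" if "d i j \<noteq> g" "i < m" "j < m" for i j
      using vw that by (simp add: degree_component_index_eq_0)
    then have "d i j = g" if "v $$ (i, j) + w $$ (i, j) \<noteq> 0" "i < m" "j < m" for i j
      using that by blast
    then show "v \<oplus>\<^bsub>module_mat TYPE('k) m m\<^esub> w \<in> degree_component m d g"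
      using vw by (auto simp: degree_component_def module_mat_simps)
  qed (auto simp: degree_component_def module_mat_simps)
qed

text \<open>A nonzero entry of \<open>x y\<close> at \<open>(i, k)\<close> needs nonzero entries of \<open>x\<close> at \<open>(i, j)\<close> and of \<open>y\<close> at
  \<open>(j, k)\<close> for some \<open>j\<close>, so its degree is the product of their degrees.\<close>

lemma degree_grading_good:
  assumes "group G" "degree_function G m d"
  shows "degree_grading G m d \<in> good_gradings TYPE('k::field) G m"
proof -
  have d: "\<And>i j. i < m \<Longrightarrow> j < m \<Longrightarrow> d i j \<in> carrier G"
    and mult: "\<And>i j k. i < m \<Longrightarrow> j < m \<Longrightarrow> k < m \<Longrightarrow> d i j \<otimes>\<^bsub>G\<^esub> d j k = d i k"
    using assms(2) by (auto simp: degree_function_def)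
  have closed: "g \<otimes>\<^bsub>G\<^esub> h \<in> carrier G" if "g \<in> carrier G" "h \<in> carrier G" for g h
    using that group.is_monoid[OF assms(1)] by (simp add: monoid.m_closed)
  have "internal_direct_sum (module_mat TYPE('k) m m) (carrier G) (degree_grading G m d)"
    using internal_direct_sum_degree_components[of m d "carrier G"] d
    by (simp add: internal_direct_sum_def degree_grading_def cong: PiE_cong)
  moreover have "x * y \<in> degree_component m d (g \<otimes>\<^bsub>G\<^esub> h)"
    if x: "x \<in> degree_component m d g" and y: "y \<in> degree_component m d h" for g h and x y :: "'k mat"
  proof -
    have "d i k = g \<otimes>\<^bsub>G\<^esub> h" if ik: "i < m" "k < m" and nz: "(x * y) $$ (i, k) \<noteq> 0" for i k
    proof -
      have "(\<Sum>j<m. x $$ (i, j) * y $$ (j, k)) \<noteq> 0"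
        using nz x y ik index_mult_mat_sum[of x m y i k] by (simp add: degree_component_def)
      then obtain j where j: "j < m" "x $$ (i, j) * y $$ (j, k) \<noteq> 0"
        by (meson lessThan_iff sum.not_neutral_contains_not_neutral)
      then have "d i j = g" "d j k = h" using x y ik by (auto simp: degree_component_def)
      then show ?thesis using mult[OF ik(1) j(1) ik(2)] by simp
    qed
    then show ?thesis using x y by (auto simp: degree_component_def)
  qed
  ultimately show ?thesis
    using d closed by (auto simp: good_gradings_def is_grading_def degree_grading_def module_mat_simps
        subspace_degree_component)
qed

text \<open>An element of \<open>A i\<close> is its own decomposition with respect to \<open>A\<close>, but its decomposition with
  respect to \<open>C\<close> is also one with respect to \<open>A\<close>.  By uniqueness they agree, so the element lies in
  \<open>C i\<close>.\<close>

lemma internal_direct_sum_refinement: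
  assumes "abelian_monoid M" "internal_direct_sum M I A" "internal_direct_sum M I C"
    and sub: "\<And>i. i \<in> I \<Longrightarrow> C i \<subseteq> A i" "\<And>i. i \<in> I \<Longrightarrow> A i \<subseteq> carrier M"
      "\<And>i. i \<in> I \<Longrightarrow> \<zero>\<^bsub>M\<^esub> \<in> C i"
    and i: "i \<in> I"
  shows "A i = C i"
proof
  interpret abelian_monoid M by fact
  show "A i \<subseteq> C i"
  proof
    fix x assume x: "x \<in> A i"
    then have xM: "x \<in> carrier M" using sub i by blast
    obtain f where f: "f \<in> (\<Pi>\<^sub>E i\<in>I. C i)" "finite {i\<in>I. f i \<noteq> \<zero>\<^bsub>M\<^esub>}"
        "x = (\<Oplus>\<^bsub>M\<^esub>i\<in>{i\<in>I. f i \<noteq> \<zero>\<^bsub>M\<^esub>}. f i)"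
      using assms(3) xM unfolding internal_direct_sum_def by meson
    have fA: "f \<in> (\<Pi>\<^sub>E i\<in>I. A i)" using f(1) sub(1) by fastforce
    \<comment> \<open>The trivial decomposition of \<open>x\<close>; its support is empty if \<open>x\<close> is zero.\<close>
    define e where "e = (\<lambda>j\<in>I. if j = i then x else \<zero>\<^bsub>M\<^esub>)"
    have eA: "e \<in> (\<Pi>\<^sub>E i\<in>I. A i)" using x subsetD[OF sub(1) sub(3)] by (auto simp: e_def)
    have supp: "{j\<in>I. e j \<noteq> \<zero>\<^bsub>M\<^esub>} = (if x = \<zero>\<^bsub>M\<^esub> then {} else {i})"
      using i by (auto simp: e_def)
    have "x = (\<Oplus>\<^bsub>M\<^esub>j\<in>{j\<in>I. e j \<noteq> \<zero>\<^bsub>M\<^esub>}. e j)"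
      unfolding supp using xM i by (auto simp: e_def)
    moreover have "finite {j\<in>I. e j \<noteq> \<zero>\<^bsub>M\<^esub>}" unfolding supp by simp
    ultimately have "f = e"
      using assms(2) xM f fA eA unfolding internal_direct_sum_def by blast
    then have "x = f i" using i by (simp add: e_def)
    then show "x \<in> C i" using f(1) i by auto
  qed
qed (use sub i in blast)

text \<open>Choose a degree \<open>d i j\<close> for every matrix unit.  Then the span of the matrix units of degree \<open>g\<close> is
  contained in \<open>A g\<close>.  Both families decompose the algebra, so
  \<open>internal_direct_sum_refinement\<close> makes them equal, and the product rule for \<open>d\<close>
  comes from \<open>e\<^sub>i\<^sub>j e\<^sub>j\<^sub>k = e\<^sub>i\<^sub>k\<close>.\<close>

lemma good_grading_is_degree_grading:
  assumes "group G" "A \<in> good_gradings TYPE('k::field) G m"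
  obtains d where "degree_function G m d" "A = degree_grading G m d"
proof -
  let ?M = "module_mat TYPE('k) m m"
  have ext: "A \<in> extensional (carrier G)"
    and subsp: "\<And>g. g \<in> carrier G \<Longrightarrow> subspace class_ring (A g) ?M"
    and dsum: "internal_direct_sum ?M (carrier G) A"
    and mult: "\<And>g h x y. \<lbrakk>g \<in> carrier G; h \<in> carrier G; x \<in> A g; y \<in> A h\<rbrakk> \<Longrightarrow> x * y \<in> A (g \<otimes>\<^bsub>G\<^esub> h)"
    and homog: "\<forall>i<m. \<forall>j<m. \<exists>g\<in>carrier G. matrix_unit m i j \<in> A g"
    using assms by (auto simp: good_gradings_def is_grading_def module_mat_simps)
  obtain d where d: "\<And>i j. i < m \<Longrightarrow> j < m \<Longrightarrow> d i j \<in> carrier G \<and> matrix_unit m i j \<in> A (d i j)"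
    using homog by metis
  have sub: "degree_component m d g \<subseteq> A g" if g: "g \<in> carrier G" for g
  proof
    fix x :: "'k mat" assume x: "x \<in> degree_component m d g"
    have sm: "submodule class_ring (A g) ?M" using subsp[OF g] by (simp add: subspace_def)
    \<comment> \<open>\<open>x\<close> is built up from multiples of matrix units, one position at a time.\<close>
    have "mat m m (\<lambda>p. if p \<in> S then x $$ p else 0) \<in> A g"
      if "finite S" "S \<subseteq> {..<m} \<times> {..<m}" for S
      using that
    proof (induction S)
      case empty
      have "mat m m (\<lambda>p. 0) = \<zero>\<^bsub>?M\<^esub>" by (auto simp: module_mat_simps)
      then show ?case using submodule.zero_closed[OF sm] by simp
    next
      case (insert p S)
      obtain i j where p: "p = (i, j)" "i < m" "j < m" using insert by auto
      let ?y = "mat m m (\<lambda>p. if p \<in> S then x $$ p else 0)"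
      have y: "?y \<in> A g" using insert by simp
      have "x $$ p \<cdot>\<^sub>m matrix_unit m i j \<in> A g"
      proof (cases "x $$ p = 0")
        case True
        then have "x $$ p \<cdot>\<^sub>m matrix_unit m i j = \<zero>\<^bsub>?M\<^esub>"
          by (auto simp: module_mat_simps matrix_unit_def intro!: eq_matI)
        then show ?thesis using submodule.zero_closed[OF sm] by simp
      next
        case False
        then have "d i j = g" using x p by (auto simp: degree_component_def)
        then show ?thesis
          using submodule.smult_closed[OF sm, of "x $$ p" "matrix_unit m i j"] d p
          by (auto simp: module_mat_simps)
      qed
      then have "?y + x $$ p \<cdot>\<^sub>m matrix_unit m i j \<in> A g"
        using submodule.m_closed[OF sm y] by (simp add: module_mat_simps)
      also have "?y + x $$ p \<cdot>\<^sub>m matrix_unit m i j = mat m m (\<lambda>q. if q \<in> insert p S then x $$ q else 0)"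
        using insert p by (intro eq_matI) (auto simp: matrix_unit_def)
      finally show ?case .
    qed
    from this[of "{..<m} \<times> {..<m}"]
    have "mat m m (\<lambda>p. if p \<in> {..<m} \<times> {..<m} then x $$ p else 0) \<in> A g" by simp
    also have "mat m m (\<lambda>p. if p \<in> {..<m} \<times> {..<m} then x $$ p else 0) = x"
      using x by (intro eq_matI) (auto simp: degree_component_def)
    finally show "x \<in> A g" .
  qed
  have eq: "A g = degree_component m d g" if "g \<in> carrier G" for g
  proof (rule internal_direct_sum_refinement[OF _ dsum _ sub _ _ that])
    show "abelian_monoid ?M" using abelian_group_mat by (rule abelian_group.axioms)
    show "internal_direct_sum ?M (carrier G) (degree_component m d)"
      using d by (intro internal_direct_sum_degree_components) auto
    show "A h \<subseteq> carrier ?M" if "h \<in> carrier G" for h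
      using subsp[OF that] unfolding subspace_def by (blast dest: LinearCombinations.submodule.subset)
  qed (auto simp: degree_component_def module_mat_simps)
  have "d i j \<otimes>\<^bsub>G\<^esub> d j k = d i k" if "i < m" "j < m" "k < m" for i j k
  proof -
    have "matrix_unit m i k \<in> A (d i j \<otimes>\<^bsub>G\<^esub> d j k)"
      using mult[of "d i j" "d j k" "matrix_unit m i j" "matrix_unit m j k"] d that
      by (simp add: matrix_unit_mult)
    moreover have "d i j \<otimes>\<^bsub>G\<^esub> d j k \<in> carrier G"
      using d that group.is_monoid[OF assms(1)] by (simp add: monoid.m_closed)
    ultimately show ?thesis using eq that by simp
  qed
  then have "degree_function G m d" using d by (auto simp: degree_function_def)
  moreover have "A = degree_grading G m d"
    by (rule extensionalityI[OF ext]) (auto simp: degree_grading_def eq)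
  ultimately show ?thesis by (rule that)
qed

section \<open>Isomorphisms of good gradings\<close>

text \<open>Permuting rows and columns simultaneously is conjugation with a permutation matrix.\<close>

lemma permuted_degrees_isomorphic:
  assumes p: "p permutes {..<m}"
    and d: "\<And>i j. i < m \<Longrightarrow> j < m \<Longrightarrow> d' i j = d (p i) (p j)"
  shows "gradings_isomorphic (class_ring :: 'k::field ring) G
    (module_mat TYPE('k) m m) (module_mat TYPE('k) m m) (degree_grading G m d) (degree_grading G m d')"
proof -
  let ?M = "module_mat TYPE('k) m m"
  let ?q = "inv_into UNIV p"
  define \<phi> where "\<phi> p x = mat m m (\<lambda>(i, j). x $$ (p i, p j))" for p :: "nat \<Rightarrow> nat" and x :: "'k mat"
  have q: "?q permutes {..<m}" by (rule permutes_inv[OF p])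
  have lt: "p i < m" "?q i < m" if "i < m" for i
    using that permutes_in_image[OF p, of i] permutes_in_image[OF q, of i] by auto
  have pq: "p (?q i) = i" "?q (p i) = i" for i
    by (rule permutes_inverses[OF p])+
  have inverse: "\<phi> ?q (\<phi> p x) = x" "\<phi> p (\<phi> ?q x) = x" if "x \<in> carrier_mat m m" for x
    using that lt by (auto simp: \<phi>_def pq intro!: eq_matI)
  have carrier: "\<phi> r x \<in> carrier_mat m m" for r x by (simp add: \<phi>_def)
  have "bij_betw (\<phi> p) (carrier ?M) (carrier ?M)"
    by (rule bij_betw_byWitness[where f' = "\<phi> ?q"])
      (auto simp: module_mat_simps inverse carrier)
  moreover have "\<phi> p \<in> Ring.ring_hom ?M ?M"
  proof (rule Ring.ring_hom_memI)
    fix x y assume "x \<in> carrier ?M" "y \<in> carrier ?M"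
    then have xy: "x \<in> carrier_mat m m" "y \<in> carrier_mat m m" by (simp_all add: module_mat_simps)
    have "\<phi> p (x * y) = \<phi> p x * \<phi> p y"
    proof (rule eq_matI)
      fix i j assume "i < dim_row (\<phi> p x * \<phi> p y)" "j < dim_col (\<phi> p x * \<phi> p y)"
      then have ij: "i < m" "j < m" by (auto simp: \<phi>_def)
      have "\<phi> p (x * y) $$ (i, j) = (\<Sum>k<m. x $$ (p i, k) * y $$ (k, p j))"
        using ij xy lt by (simp add: \<phi>_def index_mult_mat_sum[of _ m] del: index_mult_mat)
      also have "\<dots> = (\<Sum>k<m. x $$ (p i, p k) * y $$ (p k, p j))"
        using sum.permute[OF p, of "\<lambda>k. x $$ (p i, k) * y $$ (k, p j)"] by (simp add: o_def)
      also have "\<dots> = (\<phi> p x * \<phi> p y) $$ (i, j)"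
        using ij carrier by (subst index_mult_mat_sum[of _ m]) (auto simp: \<phi>_def)
      finally show "\<phi> p (x * y) $$ (i, j) = (\<phi> p x * \<phi> p y) $$ (i, j)" .
    qed (auto simp: \<phi>_def)
    then show "\<phi> p (x \<otimes>\<^bsub>?M\<^esub> y) = \<phi> p x \<otimes>\<^bsub>?M\<^esub> \<phi> p y" by (simp add: module_mat_simps)
    show "\<phi> p (x \<oplus>\<^bsub>?M\<^esub> y) = \<phi> p x \<oplus>\<^bsub>?M\<^esub> \<phi> p y"
      using xy lt by (auto simp: module_mat_simps \<phi>_def intro!: eq_matI)
  next
    have "p i = p j \<longleftrightarrow> i = j" for i j using pq by metis
    then show "\<phi> p \<one>\<^bsub>?M\<^esub> = \<one>\<^bsub>?M\<^esub>"
      using lt by (auto simp: module_mat_simps \<phi>_def intro!: eq_matI)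
  qed (auto simp: module_mat_simps carrier)
  moreover have "\<phi> p (c \<cdot>\<^sub>m x) = c \<cdot>\<^sub>m \<phi> p x" if "x \<in> carrier_mat m m" for c x
    using that lt by (auto simp: \<phi>_def intro!: eq_matI)
  ultimately have "\<phi> p \<in> algebra_iso class_ring ?M ?M"
    by (auto simp: algebra_iso_def ring_iso_def module_mat_simps)
  moreover have "\<phi> p ` degree_component m d g = degree_component m d' g" for g
  proof
    show "\<phi> p ` degree_component m d g \<subseteq> degree_component m d' g"
      using lt d by (auto simp: \<phi>_def degree_component_def)
    have "d i j = d' (?q i) (?q j)" if "i < m" "j < m" for i j
      using that lt d pq by simp
    then have "\<phi> ?q y \<in> degree_component m d g" if "y \<in> degree_component m d' g" for y
      using that lt by (auto simp: \<phi>_def degree_component_def)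
    moreover have "y = \<phi> p (\<phi> ?q y)" if "y \<in> degree_component m d' g" for y
      using that inverse by (auto simp: degree_component_def)
    ultimately show "degree_component m d' g \<subseteq> \<phi> p ` degree_component m d g" by blast
  qed
  ultimately show ?thesis
    unfolding gradings_isomorphic_def by (auto simp: degree_grading_def intro!: bexI[of _ "\<phi> p"])
qed

text \<open>One of the summands of the Leibniz formula must be nonzero.\<close>

lemma nonzero_det_nonzero_transversal:
  fixes Z :: "'k::field mat"
  assumes "Z \<in> carrier_mat m m" "det Z \<noteq> 0"
  obtains p where "p permutes {..<m}" "\<And>i. i < m \<Longrightarrow> Z $$ (i, p i) \<noteq> 0"
proof -
  obtain p where p: "p permutes {0..<m}" "signof p * (\<Prod>i = 0..<m. Z $$ (i, p i)) \<noteq> 0"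
    using assms(2) unfolding det_def'[OF assms(1)]
    by (metis (mono_tags, lifting) mem_Collect_eq sum.not_neutral_contains_not_neutral)
  then have "(\<Prod>i = 0..<m. Z $$ (i, p i)) \<noteq> 0" by auto
  then have "Z $$ (i, p i) \<noteq> 0" if "i < m" for i using that by (simp add: prod_zero_iff)
  with p(1) show ?thesis by (intro that[of p]) (auto simp: lessThan_atLeast0)
qed

text \<open>Let \<open>Z\<close> have the \<open>j\<close>-th columns of \<open>\<phi> e\<^sub>0\<^sub>0, \<phi> e\<^sub>1\<^sub>0, \<dots>\<close> as its columns, where \<open>j\<close> is chosen such that the
  \<open>j\<close>-th column of \<open>\<phi> e\<^sub>0\<^sub>0\<close> is nonzero.  If \<open>Z v = 0\<close> with \<open>v\<^sub>l \<noteq> 0\<close>, then the matrix \<open>x\<close> with first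
  column \<open>v\<close> and zeros elsewhere is mapped to a matrix with zero \<open>j\<close>-th column.  Multiplying by \<open>\<phi> e\<^sub>0\<^sub>l\<close>
  from the left gives \<open>v\<^sub>l \<phi> e\<^sub>0\<^sub>0\<close>, whose \<open>j\<close>-th column would vanish as well.  So \<open>Z\<close> is invertible and
  contains a nonzero transversal, whose entries lie in homogeneous matrices and
  reveal the degrees.\<close>

lemma isomorphic_degrees_permuted:
  assumes m: "m > 0" and d: "\<And>i j. i < m \<Longrightarrow> j < m \<Longrightarrow> d i j \<in> carrier G"
    and iso: "gradings_isomorphic (class_ring :: 'k::field ring) G
    (module_mat TYPE('k) m m) (module_mat TYPE('k) m m) (degree_grading G m d) (degree_grading G m d')"
  obtains p j where "p permutes {..<m}" "j < m" "\<And>i. i < m \<Longrightarrow> d' i j = d (p i) 0"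
proof -
  let ?M = "module_mat TYPE('k) m m"
  let ?e = "matrix_unit m :: nat \<Rightarrow> nat \<Rightarrow> 'k mat"
  obtain \<phi> where \<phi>: "\<phi> \<in> algebra_iso class_ring ?M ?M"
      and deg: "\<And>g. g \<in> carrier G \<Longrightarrow> \<phi> ` degree_component m d g = degree_component m d' g"
    using iso by (auto simp: gradings_isomorphic_def degree_grading_def)
  have bij: "bij_betw \<phi> (carrier_mat m m) (carrier_mat m m)"
    and mult: "\<And>x y. x \<in> carrier_mat m m \<Longrightarrow> y \<in> carrier_mat m m \<Longrightarrow> \<phi> (x * y) = \<phi> x * \<phi> y"
    and add: "\<And>x y. x \<in> carrier_mat m m \<Longrightarrow> y \<in> carrier_mat m m \<Longrightarrow> \<phi> (x + y) = \<phi> x + \<phi> y"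
    and smult: "\<And>c x. x \<in> carrier_mat m m \<Longrightarrow> \<phi> (c \<cdot>\<^sub>m x) = c \<cdot>\<^sub>m \<phi> x"
    using \<phi> by (auto simp: algebra_iso_def ring_iso_def Ring.ring_hom_def module_mat_simps)
  have carrier: "\<phi> x \<in> carrier_mat m m" if "x \<in> carrier_mat m m" for x
    using bij that by (auto simp: bij_betw_def)
  have zero: "\<phi> (0\<^sub>m m m) = 0\<^sub>m m m"
  proof -
    have "0\<^sub>m m m = 0 \<cdot>\<^sub>m (0\<^sub>m m m :: 'k mat)" by auto
    then have "\<phi> (0\<^sub>m m m) = 0 \<cdot>\<^sub>m \<phi> (0\<^sub>m m m)" using smult[of "0\<^sub>m m m" 0] by simp
    also have "\<dots> = 0\<^sub>m m m" using carrier[of "0\<^sub>m m m"] by (intro eq_matI) auto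
    finally show ?thesis .
  qed
  have "?e 0 0 $$ (0, 0) \<noteq> 0\<^sub>m m m $$ (0, 0)" using m by simp
  then have "?e 0 0 \<noteq> 0\<^sub>m m m" by metis
  then have "\<phi> (?e 0 0) \<noteq> 0\<^sub>m m m"
    using bij zero by (metis bij_betw_inv_into_left matrix_unit_carrier zero_carrier_mat)
  then obtain r j where rj: "r < m" "j < m" "\<phi> (?e 0 0) $$ (r, j) \<noteq> 0"
    using carrier[of "?e 0 0"] by (metis carrier_matD eq_matI index_zero_mat matrix_unit_carrier)
  define Z where "Z = mat m m (\<lambda>(r, i). \<phi> (?e i 0) $$ (r, j))"
  have Z: "Z \<in> carrier_mat m m" by (simp add: Z_def)
  have "det Z \<noteq> 0"
  proof
    assume "det Z = 0"
    then obtain v where v: "v \<in> carrier_vec m" "v \<noteq> 0\<^sub>v m" "Z *\<^sub>v v = 0\<^sub>v m"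
      unfolding det_0_iff_vec_prod_zero_field[OF Z] by blast
    then obtain l where l: "l < m" "v $ l \<noteq> 0"
      by (metis carrier_vecD eq_vecI index_zero_vec(1) index_zero_vec(2))
    \<comment> \<open>Only \<open>x {..<m}\<close> matters; the partial matrices serve to expand \<open>\<phi>\<close> by linearity.\<close>
    define x where "x S = mat m m (\<lambda>(i, k). if k = 0 \<and> i \<in> S then v $ i else 0)" for S
    have x: "x S \<in> carrier_mat m m" for S by (simp add: x_def)
    have lin: "\<phi> (x S) $$ (s, j) = (\<Sum>i\<in>S. v $ i * \<phi> (?e i 0) $$ (s, j))"
      if "finite S" "S \<subseteq> {..<m}" "s < m" for S s
      using that(1,2)
    proof (induction S)
      case empty
      have "x {} = 0\<^sub>m m m" by (auto simp: x_def)
      then show ?case using zero that(3) rj by simp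
    next
      case (insert i S)
      have "x (insert i S) = v $ i \<cdot>\<^sub>m ?e i 0 + x S"
        using insert.prems insert.hyps by (intro eq_matI) (auto simp: x_def matrix_unit_def)
      then have "\<phi> (x (insert i S)) = v $ i \<cdot>\<^sub>m \<phi> (?e i 0) + \<phi> (x S)"
        using x by (simp add: add smult)
      then show ?case
        using insert carrier[OF x[of S]] carrier[of "?e i 0"] that(3) rj by simp
    qed
    have col: "\<phi> (x {..<m}) $$ (s, j) = 0" if s: "s < m" for s
    proof -
      have "(Z *\<^sub>v v) $ s = 0" using v s by simp
      then have "(\<Sum>i<m. Z $$ (s, i) * v $ i) = 0"
        using Z v(1) s by (simp add: scalar_prod_def lessThan_atLeast0)
      then show ?thesis using lin[of "{..<m}" s] s by (simp add: Z_def mult.commute)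
    qed
    \<comment> \<open>Row \<open>l\<close> of \<open>x\<close> has the single nonzero entry \<open>v\<^sub>l\<close>, and \<open>e\<^sub>0\<^sub>l\<close> moves it to the corner.\<close>
    have "?e 0 l * x {..<m} = v $ l \<cdot>\<^sub>m ?e 0 0"
    proof (rule eq_matI)
      fix a b assume "a < dim_row (v $ l \<cdot>\<^sub>m ?e 0 0)" "b < dim_col (v $ l \<cdot>\<^sub>m ?e 0 0)"
      then have ab: "a < m" "b < m" by (auto simp: matrix_unit_def)
      have "(?e 0 l * x {..<m}) $$ (a, b) = (\<Sum>k<m. ?e 0 l $$ (a, k) * x {..<m} $$ (k, b))"
        using ab x by (simp add: index_mult_mat_sum[of _ m] del: index_mult_mat)
      also have "\<dots> = (\<Sum>k<m. if k = l then (if a = 0 \<and> b = 0 then v $ l else 0) else 0)"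
        using ab by (intro sum.cong) (auto simp: x_def)
      finally show "(?e 0 l * x {..<m}) $$ (a, b) = (v $ l \<cdot>\<^sub>m ?e 0 0) $$ (a, b)"
        using ab l by (simp add: matrix_unit_def)
    qed (auto simp: matrix_unit_def x_def)
    then have "\<phi> (?e 0 l) * \<phi> (x {..<m}) = v $ l \<cdot>\<^sub>m \<phi> (?e 0 0)"
      using mult[of "?e 0 l" "x {..<m}"] x smult by simp
    moreover have "(\<phi> (?e 0 l) * \<phi> (x {..<m})) $$ (r, j) = 0"
      using carrier x rj col by (subst index_mult_mat_sum[of _ m]) auto
    ultimately have "v $ l * \<phi> (?e 0 0) $$ (r, j) = 0"
      using carrier[of "?e 0 0"] rj by simp
    then show False using l rj by simp
  qed
  then obtain p where p: "p permutes {..<m}" "\<And>i. i < m \<Longrightarrow> Z $$ (i, p i) \<noteq> 0"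
    using nonzero_det_nonzero_transversal[OF Z] by blast
  have "d' i j = d (p i) 0" if i: "i < m" for i
  proof -
    have pi: "p i < m" using permutes_in_image[OF p(1), of i] i by simp
    have "\<phi> (?e (p i) 0) \<in> degree_component m d' (d (p i) 0)"
      using deg[OF d[OF pi m]] pi m by (metis imageI matrix_unit_in_degree_component)
    moreover have "\<phi> (?e (p i) 0) $$ (i, j) \<noteq> 0" using p(2)[OF i] i pi by (simp add: Z_def)
    ultimately show ?thesis using i rj by (auto simp: degree_component_def)
  qed
  with p(1) rj(2) show ?thesis by (rule that)
qed

section \<open>Gradings by a finite cyclic group\<close>

text \<open>The tuple is read off from the grading \<open>A\<close> itself; \<open>weight_tuple_degree_grading\<close> expresses it
  through the degree function.\<close>

definition weight_tuple ::
  "('g, 'b) monoid_scheme \<Rightarrow> nat \<Rightarrow> nat \<Rightarrow> 'g \<Rightarrow> ('g \<Rightarrow> 'k::field mat set) \<Rightarrow> nat \<Rightarrow> (nat \<Rightarrow> nat)" where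
  "weight_tuple G n m a A j =
    (\<lambda>i\<in>{1..n}. card {r. r < m \<and> matrix_unit m r j \<in> A (a [^]\<^bsub>G\<^esub> i)})"

text \<open>List a multiset in which each \<open>i\<close> has multiplicity \<open>\<alpha> i\<close>.\<close>

lemma exists_function_with_fibre_cards:
  assumes "\<alpha> \<in> F_set n m"
  obtains w where "\<And>r. r < m \<Longrightarrow> w r \<in> {1..n}" "\<And>i. i \<in> {1..n} \<Longrightarrow> card {r. r < m \<and> w r = i} = \<alpha> i"
proof -
  define X where "X = (\<Sum>i\<in>{1..n}. replicate_mset (\<alpha> i) i)"
  obtain xs where xs: "mset xs = X" using ex_mset by blast
  have "size X = (\<Sum>i\<in>{1..n}. \<alpha> i)" by (simp add: X_def size_multiset_sum)
  then have len: "length xs = m" using assms xs by (metis (mono_tags, lifting) F_set_def mem_Collect_eq size_mset)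
  have count: "count X i = (if i \<in> {1..n} then \<alpha> i else 0)" for i
    by (simp add: X_def count_sum count_replicate_mset)
  have card: "card {r. r < m \<and> xs ! r = i} = count X i" for i
  proof -
    have "card {r. r < m \<and> xs ! r = i} = length (filter ((=) i) xs)"
      unfolding length_filter_conv_card len by (rule arg_cong[of _ _ card]) auto
    then show ?thesis by (simp flip: xs add: count_mset count_list_eq_length_filter)
  qed
  show ?thesis
  proof (rule that[of "\<lambda>r. xs ! r"])
    fix r assume "r < m"
    then have "xs ! r \<in># X" using xs len by (metis nth_mem set_mset_mset)
    then show "xs ! r \<in> {1..n}" using count[of "xs ! r"] by (metis count_eq_zero_iff)
  qed (simp add: card count)
qed

text \<open>Both functions enumerate the same multiset of values.\<close>

lemma permutation_of_equal_fibre_cards: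
  fixes f h :: "nat \<Rightarrow> 'c"
  assumes "\<And>r. r < m \<Longrightarrow> f r \<in> C" "\<And>r. r < m \<Longrightarrow> h r \<in> C"
    "\<And>g. g \<in> C \<Longrightarrow> card {r. r < m \<and> f r = g} = card {r. r < m \<and> h r = g}"
  obtains p where "p permutes {..<m}" "\<And>r. r < m \<Longrightarrow> f r = h (p r)"
proof -
  have "card {r. r < m \<and> f r = g} = card {r. r < m \<and> h r = g}" for g
  proof (cases "g \<in> C")
    case False
    then have "{r. r < m \<and> f r = g} = {}" "{r. r < m \<and> h r = g} = {}" using assms by auto
    then show ?thesis by (simp only:)
  qed (use assms(3) in auto)
  moreover have "count (image_mset u (mset_set {..<m})) g = card {r. r < m \<and> u r = g}" for u :: "nat \<Rightarrow> 'c" and g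
  proof -
    have "u -` {g} \<inter> {..<m} = {r. r < m \<and> u r = g}" by auto
    then show ?thesis by (simp add: count_image_mset)
  qed
  ultimately have "image_mset f (mset_set {..<m}) = image_mset h (mset_set {..<m})"
    by (intro multiset_eqI) simp
  then obtain p where "p permutes {..<m}" "\<forall>x\<in>{..<m}. f x = h (p x)"
    by (rule image_mset_eq_implies_permutes[OF finite_lessThan])
  then show ?thesis by (intro that) auto
qed

text \<open>The powers of \<open>a\<close> are numbered by the exponents \<open>1, \<dots>, n\<close>, the positions that the shift
  permutes.\<close>

locale finite_cyclic_group = group G for G (structure) +
  fixes n :: nat and a
  assumes generator_closed [simp]: "a \<in> carrier G"
    and generates: "carrier G = range (\<lambda>k::int. a [^] k)"
    and order_eq: "Coset.order G = n"
    and order_pos: "n > 0"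
begin

lemma pow_order [simp]: "a [^] n = \<one>"
  using pow_order_eq_1[of a] order_eq by simp

lemma pow_mod: "a [^] (k mod n) = a [^] k" for k :: nat
proof -
  have "a [^] k = a [^] (n * (k div n) + k mod n)" by simp
  also have "\<dots> = (a [^] n) [^] (k div n) \<otimes> a [^] (k mod n)"
    by (simp only: nat_pow_mult[symmetric] nat_pow_pow generator_closed)
  finally show ?thesis by simp
qed

text \<open>Under this numbering the shift becomes multiplication by the generator.\<close>

lemma pow_tau_funpow:
  assumes "i \<in> {1..n}"
  shows "a [^] ((tau n ^^ k) i) = a [^] (i + k)"
proof -
  have "a [^] ((tau n ^^ k) i) = a [^] ((i - 1 + k) mod n) \<otimes> a"
    by (simp add: tau_funpow[OF assms])
  also have "\<dots> = a [^] (Suc (i - 1 + k))" by (simp add: pow_mod)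
  also have "Suc (i - 1 + k) = i + k" using assms by simp
  finally show ?thesis .
qed

lemma bij_betw_powers: "bij_betw (\<lambda>i::nat. a [^] i) {1..n} (carrier G)"
proof -
  have surj: "(\<lambda>i::nat. a [^] i) ` {1..n} = carrier G"
  proof
    show "carrier G \<subseteq> (\<lambda>i::nat. a [^] i) ` {1..n}"
    proof
      fix g assume "g \<in> carrier G"
      then obtain k :: int where k: "g = a [^] k" using generates by auto
      define j where "j = nat (k mod int n)"
      have "k = int n * (k div int n) + int j" using order_pos by (simp add: j_def)
      then have "g = (a [^] int n) [^] (k div int n) \<otimes> a [^] int j"
        using k by (metis generator_closed int_pow_mult int_pow_pow)
      then have g: "g = a [^] j" by (simp add: int_pow_int)
      have "j < n" using order_pos by (simp add: j_def nat_less_iff)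
      then show "g \<in> (\<lambda>i::nat. a [^] i) ` {1..n}"
        using g order_pos by (cases "j = 0") (auto intro: image_eqI[of _ _ n] image_eqI[of _ _ j])
    qed
  qed auto
  moreover have "card (carrier G) = n" using order_eq by (simp add: Coset.order_def)
  ultimately show ?thesis
    by (auto simp: bij_betw_def intro!: eq_card_imp_inj_on)
qed

lemma power_eq_iff:
  "i \<in> {1..n} \<Longrightarrow> j \<in> {1..n} \<Longrightarrow> a [^] i = a [^] j \<longleftrightarrow> i = j" for i j :: nat
  using inj_on_eq_iff[OF bij_betw_imp_inj_on[OF bij_betw_powers]] by blast

lemma power_index:
  assumes "g \<in> carrier G"
  shows "\<exists>i\<in>{1..n}. g = a [^] i"
  using assms bij_betw_powers by (auto simp: bij_betw_def)

lemma degree_function_closed: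
  "degree_function G m d \<Longrightarrow> i < m \<Longrightarrow> j < m \<Longrightarrow> d i j \<in> carrier G"
  by (simp add: degree_function_def)

lemma degree_function_diag:
  assumes "degree_function G m d" "i < m"
  shows "d i i = \<one>"
  using assms by (metis degree_function_def l_cancel_one)

text \<open>Every column determines the degree function; comparing gradings therefore reduces to comparing
  single columns.\<close>

lemma degree_function_from_column:
  assumes d: "degree_function G m d" and "i < m" "j < m" "l < m"
  shows "d i j = d i l \<otimes> inv (d j l)"
proof -
  have "d l j \<otimes> d j l = \<one>" "d i j = d i l \<otimes> d l j"
    using assms degree_function_diag[OF d] by (auto simp: degree_function_def)
  moreover have "d l j \<in> carrier G" "d j l \<in> carrier G" using assms by (auto simp: degree_function_def)
  ultimately show ?thesis using inv_equality by metis
qed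

lemma weight_tuple_degree_grading:
  assumes "degree_function G m d" "j < m"
  shows "weight_tuple G n m a (degree_grading G m d :: 'a \<Rightarrow> 'k::field mat set) j
    = (\<lambda>i\<in>{1..n}. card {r. r < m \<and> d r j = a [^] i})"
proof -
  have "{r. r < m \<and> matrix_unit m r j \<in> (degree_grading G m d (a [^] i) :: 'k mat set)}
      = {r. r < m \<and> d r j = a [^] i}" for i :: nat
    using assms(2) by (auto simp: degree_grading_def)
  then show ?thesis by (simp add: weight_tuple_def)
qed

text \<open>The \<open>m\<close> rows are distributed over the \<open>n\<close> powers of the generator.\<close>

lemma weight_tuple_in_F_set:
  assumes d: "degree_function G m d" and j: "j < m"
  shows "weight_tuple G n m a (degree_grading G m d :: 'a \<Rightarrow> 'k::field mat set) j \<in> F_set n m"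
proof -
  have "(\<Sum>i\<in>{1..n}. card {r. r < m \<and> d r j = a [^] i})
      = card (\<Union>i\<in>{1..n}. {r. r < m \<and> d r j = a [^] i})"
  proof (rule card_UN_disjoint[symmetric])
    have "i = i'" if "i \<in> {1..n}" "i' \<in> {1..n}" "d r j = a [^] i" "d r j = a [^] i'" for i i' r
      using that power_eq_iff[OF that(1,2)] by simp
    then show "\<forall>i\<in>{1..n}. \<forall>i'\<in>{1..n}. i \<noteq> i' \<longrightarrow>
        {r. r < m \<and> d r j = a [^] i} \<inter> {r. r < m \<and> d r j = a [^] i'} = {}"
      by blast
  qed auto
  also have "(\<Union>i\<in>{1..n}. {r. r < m \<and> d r j = a [^] i}) = {..<m}"
  proof -
    have "\<exists>i\<in>{1..n}. d r j = a [^] i" if "r < m" for r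
      by (rule power_index[OF degree_function_closed[OF d that j]])
    then show ?thesis by blast
  qed
  finally show ?thesis using assms by (simp add: weight_tuple_degree_grading F_set_def)
qed

lemma eq_shift_iff:
  assumes "\<alpha> \<in> F_set n m" "\<beta> \<in> F_set n m"
  shows "\<beta> = (tuple_act (tau n) ^^ k) \<alpha> \<longleftrightarrow> (\<forall>i\<in>{1..n}. \<beta> ((tau n ^^ k) i) = \<alpha> i)"
proof
  assume *: "\<forall>i\<in>{1..n}. \<beta> ((tau n ^^ k) i) = \<alpha> i"
  show "\<beta> = (tuple_act (tau n) ^^ k) \<alpha>"
  proof (rule extensionalityI[of _ "{1..n}"])
    fix i' assume "i' \<in> {1..n}"
    then obtain i where i: "i \<in> {1..n}" "i' = (tau n ^^ k) i"
      using permutes_image[OF tau_funpow_permutes] by (metis imageE)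
    then show "\<beta> i' = (tuple_act (tau n) ^^ k) \<alpha> i'"
      using * tuple_act_funpow_apply[of k n \<alpha> i] by simp
  qed (use assms tuple_act_F_set[OF assms(1)] in \<open>simp_all add: F_set_def PiE_def\<close>)
qed (simp add: tuple_act_funpow_apply)

text \<open>A shift by \<open>k\<close> corresponds to multiplying all degrees in the column by \<open>a\<^sup>k\<close>.\<close>

lemma weight_tuple_eq_shift_iff:
  fixes d d' :: "nat \<Rightarrow> nat \<Rightarrow> 'a"
  assumes d: "degree_function G m d" "degree_function G m d'" and j: "j < m" "j' < m"
  shows "weight_tuple G n m a (degree_grading G m d' :: 'a \<Rightarrow> 'k::field mat set) j'
      = (tuple_act (tau n) ^^ k) (weight_tuple G n m a (degree_grading G m d :: 'a \<Rightarrow> 'k mat set) j)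
    \<longleftrightarrow> (\<forall>g\<in>carrier G. card {r. r < m \<and> d' r j' = g} = card {r. r < m \<and> d r j \<otimes> a [^] k = g})"
    (is "?l \<longleftrightarrow> ?r")
proof -
  have tau: "(tau n ^^ k) i \<in> {1..n}" if "i \<in> {1..n}" for i
    using that permutes_in_image[OF tau_funpow_permutes] by blast
  have "{r. r < m \<and> d r j \<otimes> a [^] k = a [^] (i + k)} = {r. r < m \<and> d r j = a [^] i}" for i
  proof -
    have "d r j \<otimes> a [^] k = a [^] i \<otimes> a [^] k \<longleftrightarrow> d r j = a [^] i" if "r < m" for r
      using d(1) j that by (intro right_cancel) (auto simp: degree_function_def)
    then show ?thesis by (auto simp: nat_pow_mult)
  qed
  then have "?l \<longleftrightarrow> (\<forall>i\<in>{1..n}. card {r. r < m \<and> d' r j' = a [^] ((tau n ^^ k) i)}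
      = card {r. r < m \<and> d r j \<otimes> a [^] k = a [^] ((tau n ^^ k) i)})"
    using tau by (subst eq_shift_iff[OF weight_tuple_in_F_set weight_tuple_in_F_set, OF d(1) j(1) d(2) j(2)])
      (auto simp: weight_tuple_degree_grading d j pow_tau_funpow)
  also have "\<dots> \<longleftrightarrow> ?r"
  proof -
    have "carrier G = (\<lambda>i. a [^] ((tau n ^^ k) i)) ` {1..n}"
      using bij_betw_powers permutes_image[OF tau_funpow_permutes, of k n]
      by (simp add: bij_betw_def flip: image_image)
    then show ?thesis by auto
  qed
  finally show ?thesis .
qed

lemma orbit_eq_iff:
  "orbit (H_group n) tuple_act \<alpha> = orbit (H_group n) tuple_act \<beta>
    \<longleftrightarrow> (\<exists>k. \<beta> = (tuple_act (tau n) ^^ k) \<alpha>)"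
proof
  assume "orbit (H_group n) tuple_act \<alpha> = orbit (H_group n) tuple_act \<beta>"
  moreover have "\<beta> \<in> orbit (H_group n) tuple_act \<beta>"
    unfolding orbit_H_group[OF order_pos] by (rule image_eqI[of _ _ 0]) auto
  ultimately show "\<exists>k. \<beta> = (tuple_act (tau n) ^^ k) \<alpha>"
    unfolding orbit_H_group[OF order_pos] by auto
next
  assume "\<exists>k. \<beta> = (tuple_act (tau n) ^^ k) \<alpha>"
  then show "orbit (H_group n) tuple_act \<alpha> = orbit (H_group n) tuple_act \<beta>"
    unfolding orbit_H_group[OF order_pos]
    using range_funpow_shift[OF tuple_act_tau_n order_pos] by metis
qed

text \<open>Column \<open>l\<close> arises from column \<open>j\<close> by right multiplication with \<open>d j l\<close>.\<close>

lemma weight_tuple_change_column: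
  fixes d :: "nat \<Rightarrow> nat \<Rightarrow> 'a"
  assumes d: "degree_function G m d" and j: "j < m" "l < m"
  shows "orbit (H_group n) tuple_act (weight_tuple G n m a (degree_grading G m d :: 'a \<Rightarrow> 'k::field mat set) j)
       = orbit (H_group n) tuple_act (weight_tuple G n m a (degree_grading G m d :: 'a \<Rightarrow> 'k mat set) l)"
proof -
  obtain k :: nat where k: "d j l = a [^] k"
    using power_index[OF degree_function_closed[OF d j]] by auto
  have "d r j \<otimes> a [^] k = d r l" if "r < m" for r
    using d j that by (simp add: degree_function_def flip: k)
  then have "{r. r < m \<and> d r l = g} = {r. r < m \<and> d r j \<otimes> a [^] k = g}" for g by auto
  then show ?thesis
    unfolding orbit_eq_iff by (intro exI[of _ k]) (simp add: weight_tuple_eq_shift_iff d j)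
qed

text \<open>From an isomorphism, column \<open>j\<close> of one grading has the same weight tuple as column 0 of the
  other, and the choice of the column does not affect the orbit.  Conversely, equal orbits mean that the
  columns agree up to a permutation and a common factor \<open>a\<^sup>k\<close>, and this factor cancels in
  \<open>d i j = d i 0 \<cdot> (d j 0)\<^sup>-\<^sup>1\<close>.\<close>

lemma gradings_isomorphic_iff:
  fixes d d' :: "nat \<Rightarrow> nat \<Rightarrow> 'a"
  assumes d: "degree_function G m d" "degree_function G m d'" and m: "m > 0"
  shows "gradings_isomorphic (class_ring :: 'k::field ring) G
      (module_mat TYPE('k) m m) (module_mat TYPE('k) m m) (degree_grading G m d) (degree_grading G m d')
    \<longleftrightarrow> orbit (H_group n) tuple_act (weight_tuple G n m a (degree_grading G m d :: 'a \<Rightarrow> 'k mat set) 0)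
      = orbit (H_group n) tuple_act (weight_tuple G n m a (degree_grading G m d' :: 'a \<Rightarrow> 'k mat set) 0)"
    (is "?iso \<longleftrightarrow> ?orb")
proof
  assume iso: ?iso
  obtain p j where p: "p permutes {..<m}" and j: "j < m" and eq: "\<And>i. i < m \<Longrightarrow> d' i j = d (p i) 0"
    using isomorphic_degrees_permuted[OF m _ iso] d(1) by (auto simp: degree_function_def)
  have "card {r. r < m \<and> d' r j = g} = card {r. r < m \<and> d r 0 = g}" for g
  proof (rule bij_betw_same_card)
    have lt: "p r < m \<longleftrightarrow> r < m" for r using permutes_in_image[OF p, of r] by simp
    show "bij_betw p {r. r < m \<and> d' r j = g} {r. r < m \<and> d r 0 = g}"
    proof (rule bij_betw_byWitness[where f' = "inv_into UNIV p"])
      have "inv_into UNIV p r < m" if "r < m" for r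
        using permutes_in_image[OF permutes_inv[OF p], of r] that by simp
      then show "inv_into UNIV p ` {r. r < m \<and> d r 0 = g} \<subseteq> {r. r < m \<and> d' r j = g}"
        by (auto simp: eq permutes_inverses[OF p])
    qed (auto simp: permutes_inverses[OF p] lt eq)
  qed
  moreover have "{r. r < m \<and> d r 0 \<otimes> a [^] (0::nat) = g} = {r. r < m \<and> d r 0 = g}" for g
    using d(1) m by (auto simp: degree_function_def)
  ultimately have "weight_tuple G n m a (degree_grading G m d' :: 'a \<Rightarrow> 'k mat set) j
      = (tuple_act (tau n) ^^ 0) (weight_tuple G n m a (degree_grading G m d :: 'a \<Rightarrow> 'k mat set) 0)"
    unfolding weight_tuple_eq_shift_iff[OF d m j] by simp
  then show ?orb using weight_tuple_change_column[OF d(2) j m, where 'k = 'k] by simp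
next
  assume ?orb
  then obtain k :: nat where k: "\<And>g. g \<in> carrier G \<Longrightarrow>
      card {r. r < m \<and> d' r 0 = g} = card {r. r < m \<and> d r 0 \<otimes> a [^] k = g}"
    unfolding orbit_eq_iff weight_tuple_eq_shift_iff[OF d m m] by (elim exE) simp
  have closed: "d r s \<in> carrier G" "d' r s \<in> carrier G" if "r < m" "s < m" for r s
    using d that by (auto simp: degree_function_def)
  obtain p where p: "p permutes {..<m}" and eq: "\<And>r. r < m \<Longrightarrow> d' r 0 = d (p r) 0 \<otimes> a [^] k"
  proof (rule permutation_of_equal_fibre_cards[of m "\<lambda>r. d' r 0" "carrier G" "\<lambda>r. d r 0 \<otimes> a [^] k"])
  qed (use closed m k in auto)
  have "d' r s = d (p r) (p s)" if rs: "r < m" "s < m" for r s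
  proof -
    have prs: "p r < m" "p s < m" using rs permutes_in_image[OF p] by (metis lessThan_iff)+
    have "d' r s = (d (p r) 0 \<otimes> a [^] k) \<otimes> inv (d (p s) 0 \<otimes> a [^] k)"
      using degree_function_from_column[OF d(2) rs m] eq rs by simp
    also have "\<dots> = d (p r) 0 \<otimes> inv (d (p s) 0)"
    proof -
      have "(x \<otimes> z) \<otimes> inv (y \<otimes> z) = x \<otimes> inv y"
        if "x \<in> carrier G" "y \<in> carrier G" "z \<in> carrier G" for x y z
        using that by (simp add: inv_mult_group m_assoc) (metis inv_closed m_assoc m_closed r_inv r_one l_one)
      then show ?thesis using closed(1) prs m by simp
    qed
    also have "\<dots> = d (p r) (p s)"
      using degree_function_from_column[OF d(1) prs m] by simp
    finally show ?thesis .
  qed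
  then show ?iso by (rule permuted_degrees_isomorphic[OF p])
qed

text \<open>Let \<open>w\<close> take each value \<open>i\<close> exactly \<open>\<alpha> i\<close> times, and let \<open>e\<^sub>r\<^sub>s\<close> have degree \<open>a\<^sup>w\<^sup>r a\<^sup>-\<^sup>w\<^sup>s\<close>.  Column 0 is then
  the family of the \<open>a\<^sup>w\<^sup>r\<close> divided by \<open>a\<^sup>w\<^sup>0\<close>, so its weight tuple is a shift of \<open>\<alpha>\<close>.\<close>

lemma orbit_of_good_grading:
  assumes \<alpha>: "\<alpha> \<in> F_set n m" and m: "m > 0"
  obtains d where "degree_function G m d"
    "orbit (H_group n) tuple_act (weight_tuple G n m a (degree_grading G m d :: 'a \<Rightarrow> 'k::field mat set) 0)
      = orbit (H_group n) tuple_act \<alpha>"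
proof -
  obtain w where w: "\<And>r. r < m \<Longrightarrow> w r \<in> {1..n}"
      and card: "\<And>i. i \<in> {1..n} \<Longrightarrow> card {r. r < m \<and> w r = i} = \<alpha> i"
    using exists_function_with_fibre_cards[OF \<alpha>] by blast
  define d where "d r s = a [^] w r \<otimes> inv (a [^] w s)" for r s
  have d: "degree_function G m d"
  proof -
    have "(x \<otimes> inv y) \<otimes> (y \<otimes> inv z) = x \<otimes> inv z"
      if "x \<in> carrier G" "y \<in> carrier G" "z \<in> carrier G" for x y z
      using that by (metis inv_closed inv_solve_left' m_assoc m_closed)
    then show ?thesis by (simp add: degree_function_def d_def)
  qed
  let ?W = "weight_tuple G n m a (degree_grading G m d :: 'a \<Rightarrow> 'k mat set) 0"
  have "\<alpha> = (tuple_act (tau n) ^^ w 0) ?W"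
    unfolding eq_shift_iff[OF weight_tuple_in_F_set[OF d m] \<alpha>]
  proof
    fix i assume i: "i \<in> {1..n}"
    let ?i = "(tau n ^^ w 0) i"
    have i': "?i \<in> {1..n}" using i permutes_in_image[OF tau_funpow_permutes] by blast
    have "d r 0 = a [^] i \<longleftrightarrow> w r = ?i" if "r < m" for r
    proof -
      have "d r 0 = a [^] i \<longleftrightarrow> a [^] w r = a [^] i \<otimes> a [^] w 0"
        unfolding d_def by (rule inv_solve_right') auto
      also have "\<dots> \<longleftrightarrow> w r = ?i"
        using power_eq_iff[OF w[OF that] i'] pow_tau_funpow[OF i] by (simp add: nat_pow_mult)
      finally show ?thesis .
    qed
    then have "{r. r < m \<and> d r 0 = a [^] i} = {r. r < m \<and> w r = ?i}" by auto
    then show "\<alpha> ?i = ?W i" using i card[OF i'] by (simp add: weight_tuple_degree_grading[OF d m])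
  qed
  then show ?thesis using d that orbit_eq_iff by blast
qed

lemma card_good_grading_types:
  assumes m: "m > 0"
  shows "card (good_grading_types TYPE('k::field) G m)
       = card (orbit (H_group n) tuple_act ` F_set n m)"
proof -
  let ?g = "\<lambda>A :: 'a \<Rightarrow> 'k mat set. orbit (H_group n) tuple_act (weight_tuple G n m a A 0)"
  have "card (good_grading_types TYPE('k) G m) = card (?g ` good_gradings TYPE('k) G m)"
    unfolding good_grading_types_def
  proof (rule card_quotient_of_kernel)
    fix A B assume A: "A \<in> good_gradings TYPE('k) G m" and B: "B \<in> good_gradings TYPE('k) G m"
    obtain d d' where "degree_function G m d" "A = degree_grading G m d"
        "degree_function G m d'" "B = degree_grading G m d'"
      using good_grading_is_degree_grading[OF group_axioms A]
        good_grading_is_degree_grading[OF group_axioms B] by metis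
    then show "gradings_isomorphic class_ring G (module_mat TYPE('k) m m) (module_mat TYPE('k) m m) A B
        \<longleftrightarrow> ?g A = ?g B"
      using gradings_isomorphic_iff m by blast
  qed
  also have "?g ` good_gradings TYPE('k) G m = orbit (H_group n) tuple_act ` F_set n m"
  proof
    show "?g ` good_gradings TYPE('k) G m \<subseteq> orbit (H_group n) tuple_act ` F_set n m"
    proof (rule image_subsetI)
      fix A assume "A \<in> good_gradings TYPE('k) G m"
      then obtain d where "degree_function G m d" "A = degree_grading G m d"
        by (rule good_grading_is_degree_grading[OF group_axioms])
      then show "?g A \<in> orbit (H_group n) tuple_act ` F_set n m"
        using weight_tuple_in_F_set m by blast
    qed
    show "orbit (H_group n) tuple_act ` F_set n m \<subseteq> ?g ` good_gradings TYPE('k) G m"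
    proof (rule image_subsetI)
      fix \<alpha> assume "\<alpha> \<in> F_set n m"
      then obtain d where "degree_function G m d"
          "?g (degree_grading G m d) = orbit (H_group n) tuple_act \<alpha>"
        using orbit_of_good_grading[OF _ m, where 'k = 'k] by blast
      then show "orbit (H_group n) tuple_act \<alpha> \<in> ?g ` good_gradings TYPE('k) G m"
        using degree_grading_good[OF group_axioms] by (metis image_eqI)
    qed
  qed
  finally show ?thesis .
qed

end

theorem theorem3p6:
  fixes G :: "('g, 'b) monoid_scheme" and m n :: nat
  assumes "group G" and "cyclic_group G" and "Coset.order G = n"
    and "0 < n" and "0 < m"
  shows "real (card (good_grading_types TYPE('k::field) G m))
           = (\<Sum>d\<in>D_set n m. 1 / real d * real (card (B_set n m d)))
       \<and> (\<Sum>d\<in>D_set n m. 1 / real d * real (card (B_set n m d)))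
           = (\<Sum>d\<in>D_set n m. 1 / real d *
                (real (card (A_set n m d)) - real (card (\<Union>d'\<in>D_max n m d. A_set n m d'))))"
proof -
  obtain a where "a \<in> carrier G" "carrier G = range (\<lambda>k::int. a [^]\<^bsub>G\<^esub> k)"
    using assms(2) group.cyclic_group[OF assms(1)] by blast
  then interpret finite_cyclic_group G n a
    using assms by (simp add: finite_cyclic_group_def finite_cyclic_group_axioms_def)
  show ?thesis
    using card_good_grading_types[OF assms(5), where 'k = 'k] card_orbits_F_set[OF assms(4)]
      card_B_set[OF assms(4)] by simp
qed

end
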